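(* Let $\mathcal{R}$ be a finite nonzero associative ring with $1$ (not necessarily commutative), with Jacobson radical $J(\mathcal{R})$, and let $\mathcal{R}/J(\mathcal{R})\cong M_{n_1}(\mathbb{F}_{q_1})\times\ldots\times M_{n_d}(\mathbb{F}_{q_d})$ be the Wedderburn--Artin decomposition, where each $\mathbb{F}_{q_i}$ is the finite field of cardinality $q_i$ and $n_i\geq 1$. Let $n\geq 1$, let $\preceq$ be a partial order on $\{1,\ldots,n\}$, let $\mathcal{A}=\mathcal{A}_n(\preceq,\mathcal{R})$ be the incidence ring, and put $c=|\{(i,j)\mid i\prec: j\}|$. Let $m\geq\mathrm{mgen}(\mathcal{A})$ be a natural number. Then the probability that a tuple of $m$ matrices from $\mathcal{A}$ (chosen uniformly from the finite set $\mathcal{A}^m$) together with all scalar matrices generates $\mathcal{A}$ as a ring, i.e. $P=|\mathrm{Gen}_m(\mathcal{A},\mathcal{R})|/|\mathcal{A}^m|$, is equal to $$P=\prod_{i=1}^d\left(1-\frac{1}{q_i^{n_i^2 m-1}}\right)^{c}\ \prod_{\ell=1}^{n-1}\left(1-\frac{\ell}{q_i^{n_i^2 m}}\right),$$ where both factors are inside the product over $i$ and the convention $0^0=1$ is used.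
   Context: For a partial order $\preceq$ on $\{1,\ldots,n\}$, write $i\prec j$ if $i\preceq j$ and $i\neq j$. The covering relation $i\prec: j$ means that $i\prec j$ and there is no $k$ with $i\prec k\prec j$. The incidence ring is $\mathcal{A}_n(\preceq,\mathcal{R})=\{A\in M_n(\mathcal{R})\mid (A)_{ij}=0 \text{ for all pairs } i\not\preceq j\}$, a subring of the ring $M_n(\mathcal{R})$ of $n\times n$ matrices over $\mathcal{R}$; here $(A)_{ij}$ is the $(i,j)$-th entry of $A$. $\mathcal{R}I_n=\{r\cdot I_n\mid r\in\mathcal{R}\}$ is the set of all scalar matrices. A subset $S$ of a ring $\mathcal{T}$ with identity generates $\mathcal{T}$ as a ring if the smallest subring of $\mathcal{T}$ containing $S\cup\{1_{\mathcal{T}}\}$ is $\mathcal{T}$. For a natural number $m$, $\mathrm{Gen}_m(\mathcal{A},\mathcal{R})=\{(A_1,\ldots,A_m)\in\mathcal{A}^m \mid \{A_i\}_{i=1}^m\cup\mathcal{R}I_n \text{ generates } \mathcal{A} \text{ as a ring}\}$, and $\mathrm{mgen}(\mathcal{A})=\min\{m\in\mathbb{N}\mid \mathrm{Gen}_m(\mathcal{A},\mathcal{R})\neq\varnothing\}$. *)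

theory Defs
  imports "HOL-Algebra.Algebra"
begin

definition left_ideal :: "'a set \<Rightarrow> ('a, 'b) ring_scheme \<Rightarrow> bool" where
  "left_ideal I R \<longleftrightarrow>
     additive_subgroup I R \<and> (\<forall>a\<in>I. \<forall>x\<in>carrier R. x \<otimes>\<^bsub>R\<^esub> a \<in> I)"

definition maximal_left_ideal :: "'a set \<Rightarrow> ('a, 'b) ring_scheme \<Rightarrow> bool" where
  "maximal_left_ideal I R \<longleftrightarrow>
     left_ideal I R \<and> I \<noteq> carrier R \<and>
     (\<forall>J. left_ideal J R \<and> I \<subseteq> J \<longrightarrow> J = I \<or> J = carrier R)"

definition jacobson_radical :: "('a, 'b) ring_scheme \<Rightarrow> 'a set" where
  "jacobson_radical R = carrier R \<inter> \<Inter>{I. maximal_left_ideal I R}"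

text \<open>Matrices are extensional functions on index pairs from \<open>{1..n}\<close>, so that equality
  of matrices is equality of functions and the carrier is finite when the ring is.\<close>

definition mat_ring :: "nat \<Rightarrow> ('a, 'b) ring_scheme \<Rightarrow> (nat \<times> nat \<Rightarrow> 'a) ring" where
  "mat_ring n R =
     \<lparr> carrier = {1..n} \<times> {1..n} \<rightarrow>\<^sub>E carrier R,
       monoid.mult = (\<lambda>A B. \<lambda>(i, j)\<in>{1..n} \<times> {1..n}. \<Oplus>\<^bsub>R\<^esub>k\<in>{1..n}. A (i, k) \<otimes>\<^bsub>R\<^esub> B (k, j)),
       one = (\<lambda>(i, j)\<in>{1..n} \<times> {1..n}. if i = j then \<one>\<^bsub>R\<^esub> else \<zero>\<^bsub>R\<^esub>),
       ring.zero = (\<lambda>(i, j)\<in>{1..n} \<times> {1..n}. \<zero>\<^bsub>R\<^esub>),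
       ring.add = (\<lambda>A B. \<lambda>(i, j)\<in>{1..n} \<times> {1..n}. A (i, j) \<oplus>\<^bsub>R\<^esub> B (i, j)) \<rparr>"

definition scalar_matrices :: "nat \<Rightarrow> ('a, 'b) ring_scheme \<Rightarrow> (nat \<times> nat \<Rightarrow> 'a) set" where
  "scalar_matrices n R =
     (\<lambda>r. \<lambda>(i, j)\<in>{1..n} \<times> {1..n}. r \<otimes>\<^bsub>R\<^esub> \<one>\<^bsub>mat_ring n R\<^esub> (i, j)) ` carrier R"

definition incidence_ring ::
  "nat \<Rightarrow> nat rel \<Rightarrow> ('a, 'b) ring_scheme \<Rightarrow> (nat \<times> nat \<Rightarrow> 'a) ring" where
  "incidence_ring n po R =
     (mat_ring n R) \<lparr> carrier :=
       {A \<in> carrier (mat_ring n R).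
          \<forall>i\<in>{1..n}. \<forall>j\<in>{1..n}. (i, j) \<notin> po \<longrightarrow> A (i, j) = \<zero>\<^bsub>R\<^esub>} \<rparr>"

definition strictly_below :: "'a rel \<Rightarrow> 'a \<Rightarrow> 'a \<Rightarrow> bool" where
  "strictly_below po i j \<longleftrightarrow> (i, j) \<in> po \<and> i \<noteq> j"

definition covered_by :: "'a rel \<Rightarrow> 'a \<Rightarrow> 'a \<Rightarrow> bool" where
  "covered_by po i j \<longleftrightarrow>
     strictly_below po i j \<and> \<not> (\<exists>k. strictly_below po i k \<and> strictly_below po k j)"

definition generates :: "('a, 'b) ring_scheme \<Rightarrow> 'a set \<Rightarrow> bool" where
  "generates T S \<longleftrightarrow> generate_ring T S = carrier T"

definition tuples :: "nat \<Rightarrow> 'a set \<Rightarrow> (nat \<Rightarrow> 'a) set" where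
  "tuples m B = {1..m} \<rightarrow>\<^sub>E B"

text \<open>The ring \<open>T\<close> below is a ring of \<open>n \<times> n\<close> matrices over \<open>R\<close> containing the scalar matrices.\<close>

definition Gen ::
  "nat \<Rightarrow> (nat \<times> nat \<Rightarrow> 'a, 'c) ring_scheme \<Rightarrow> nat \<Rightarrow> ('a, 'b) ring_scheme
     \<Rightarrow> (nat \<Rightarrow> nat \<times> nat \<Rightarrow> 'a) set" where
  "Gen m T n R =
     {As \<in> tuples m (carrier T). generates T (As ` {1..m} \<union> scalar_matrices n R)}"

text \<open>Here \<open>0\<close> counts as a natural number: if the scalar matrices alone generate \<open>T\<close>, then
  \<open>mgen T n R = 0\<close>. The minimum is over a nonempty set whenever \<open>T\<close> is finite.\<close>

definition mgen ::
  "(nat \<times> nat \<Rightarrow> 'a, 'c) ring_scheme \<Rightarrow> nat \<Rightarrow> ('a, 'b) ring_scheme \<Rightarrow> nat" where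
  "mgen T n R = (LEAST m. Gen m T n R \<noteq> {})"

end

theory Submission
  imports Defs
begin

text \<open>
  Let \<open>\<phi>\<^sub>k : R \<rightarrow> T\<^sub>k\<close> be the projections of \<open>R\<close> onto the simple factors of \<open>R/J(R)\<close>, and let
  \<open>V\<^sub>k = T\<^sub>k\<^sup>m\<close>. Reducing the \<open>(i, j)\<close> entries of the \<open>m\<close> matrices turns a tuple into a labelling of
  the pairs \<open>i \<preceq> j\<close> by vectors \<open>v\<^sub>k(i, j) \<in> V\<^sub>k\<close>, for every \<open>k\<close>. The tuple and the scalars generate
  the incidence ring exactly when, for each \<open>k\<close> separately,

  \<^item> the diagonal vectors \<open>v\<^sub>k(1, 1), \<dots>, v\<^sub>k(n, n)\<close> are pairwise distinct, and

  \<^item> for each cover \<open>i \<prec>: j\<close>, the vector \<open>v\<^sub>k(i, j)\<close> is not a multiple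
    \<open>(v\<^sub>k(i, i) - v\<^sub>k(j, j)) z\<close> with \<open>z\<close> in the centre of \<open>T\<^sub>k\<close>.

  Necessity holds because a relation \<open>v\<^sub>k(i, i) = v\<^sub>k(j, j)\<close>, or \<open>v\<^sub>k(i, j) = (v\<^sub>k(i, i) - v\<^sub>k(j, j)) z\<close>
  at a cover, cuts out a proper subring that contains the scalars (\<open>generators_separate\<close>).

  For sufficiency let \<open>S\<close> be the generated subring. Since \<open>S\<close> absorbs scalars from both sides, the
  values of one matrix entry on the members of \<open>S\<close> with certain other entries zero form a two-sided
  ideal of \<open>R\<close> (\<open>entry_ideal\<close>). A proper two-sided ideal is killed by some \<open>\<phi>\<^sub>k\<close>
  (\<open>proper_ideal_killed\<close>), and for a suitable choice of entries being killed contradicts one of the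
  two conditions at \<open>k\<close>. So those ideals contain \<open>1\<close>: \<open>S\<close> has members separating
  any two diagonal positions, and members with entry \<open>1\<close> at a given cover and \<open>0\<close> at its two ends.
  Multiplying such members along chains gives every matrix unit up to terms supported on longer
  chains, and chains have bounded length, so \<open>S\<close> is everything (\<open>subring_is_everything\<close>).
  The whole argument takes place over \<open>R\<close>; the radical enters only through \<open>proper_ideal_killed\<close>,
  which is an instance of Nakayama's lemma.

  The criterion splits over \<open>k\<close>, and the reduction map has fibres of constant size, so the probability
  is a product over \<open>k\<close> (\<open>generation_probability_factors\<close>). For one \<open>k\<close>, choose the diagonal
  vectors injectively in \<open>V\<^sub>k\<close>; every cover then has to avoid a line with \<open>q\<^sub>k\<close> points, since the
  centre of \<open>T\<^sub>k\<close> is the field of \<open>q\<^sub>k\<close> elements and acts freely, and the remaining entries are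
  unrestricted (\<open>labelling_probability\<close>). With \<open>|V\<^sub>k| = q\<^sub>k\<^bsup>n\<^sub>k\<^sup>2 m\<^esup>\<close> this is the formula.
\<close>

section \<open>Matrix rings and incidence rings\<close>

lemma (in abelian_monoid) finsum_exchange:
  assumes "finite A" "finite B" "\<And>i j. i \<in> A \<Longrightarrow> j \<in> B \<Longrightarrow> f i j \<in> carrier G"
  shows "(\<Oplus>i\<in>A. \<Oplus>j\<in>B. f i j) = (\<Oplus>j\<in>B. \<Oplus>i\<in>A. f i j)"
  using assms(1,3)
proof (induction A rule: finite_induct)
  case empty
  then show ?case by simp
next
  case (insert a A)
  have "(\<Oplus>j\<in>B. \<Oplus>i\<in>insert a A. f i j) = (\<Oplus>j\<in>B. f a j \<oplus> (\<Oplus>i\<in>A. f i j))"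
    using insert by (intro finsum_cong') (auto simp: Pi_def)
  also have "\<dots> = (\<Oplus>j\<in>B. f a j) \<oplus> (\<Oplus>j\<in>B. \<Oplus>i\<in>A. f i j)"
    using insert by (intro finsum_addf) (auto simp: Pi_def)
  finally show ?case
    using insert by (simp add: Pi_def)
qed

lemma (in abelian_monoid) finsum_single_term:
  assumes "finite A" "k \<in> A" "f k \<in> carrier G" "\<And>i. i \<in> A \<Longrightarrow> i \<noteq> k \<Longrightarrow> f i = \<zero>"
  shows "(\<Oplus>i\<in>A. f i) = f k"
proof -
  have f: "f i \<in> carrier G" if "i \<in> A" for i
    using assms that by (cases "i = k") auto
  have "(\<Oplus>i\<in>A. f i) = (\<Oplus>i\<in>A. if k = i then f i else \<zero>)"
    using assms f by (intro finsum_cong') (auto simp: Pi_def)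
  also have "\<dots> = f k"
    using assms f by (intro finsum_singleton) (auto simp: Pi_def)
  finally show ?thesis .
qed

lemma (in abelian_monoid) finsum_two_terms:
  assumes "finite A" "k \<in> A" "l \<in> A" "k \<noteq> l" "f k \<in> carrier G" "f l \<in> carrier G"
    "\<And>i. i \<in> A \<Longrightarrow> i \<noteq> k \<Longrightarrow> i \<noteq> l \<Longrightarrow> f i = \<zero>"
  shows "(\<Oplus>i\<in>A. f i) = f k \<oplus> f l"
proof -
  have A: "A = insert k (A - {k})"
    using assms by auto
  have "(\<Oplus>i\<in>insert k (A - {k}). f i) = f k \<oplus> (\<Oplus>i\<in>A - {k}. f i)"
  proof (rule finsum_insert)
    show "f \<in> A - {k} \<rightarrow> carrier G"
    proof
      fix x assume "x \<in> A - {k}"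
      then show "f x \<in> carrier G"
        using assms by (cases "x = l") auto
    qed
  qed (use assms in auto)
  also have "(\<Oplus>i\<in>A - {k}. f i) = f l"
    using assms by (intro finsum_single_term) auto
  finally show ?thesis
    using A by simp
qed

lemma mat_carrier: "carrier (mat_ring n R) = {1..n} \<times> {1..n} \<rightarrow>\<^sub>E carrier R"
  by (simp add: mat_ring_def)

lemma mat_add_entry:
  "\<lbrakk>i \<in> {1..n}; j \<in> {1..n}\<rbrakk> \<Longrightarrow> (A \<oplus>\<^bsub>mat_ring n R\<^esub> B) (i, j) = A (i, j) \<oplus>\<^bsub>R\<^esub> B (i, j)"
  by (simp add: mat_ring_def)

lemma mat_mult_entry:
  "\<lbrakk>i \<in> {1..n}; j \<in> {1..n}\<rbrakk> \<Longrightarrow>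
    (A \<otimes>\<^bsub>mat_ring n R\<^esub> B) (i, j) = (\<Oplus>\<^bsub>R\<^esub>k\<in>{1..n}. A (i, k) \<otimes>\<^bsub>R\<^esub> B (k, j))"
  by (simp add: mat_ring_def)

lemma mat_one_entry:
  "\<lbrakk>i \<in> {1..n}; j \<in> {1..n}\<rbrakk> \<Longrightarrow> \<one>\<^bsub>mat_ring n R\<^esub> (i, j) = (if i = j then \<one>\<^bsub>R\<^esub> else \<zero>\<^bsub>R\<^esub>)"
  by (simp add: mat_ring_def)

lemma mat_zero_entry:
  "\<lbrakk>i \<in> {1..n}; j \<in> {1..n}\<rbrakk> \<Longrightarrow> \<zero>\<^bsub>mat_ring n R\<^esub> (i, j) = \<zero>\<^bsub>R\<^esub>"
  by (simp add: mat_ring_def)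

lemmas mat_entries = mat_add_entry mat_mult_entry mat_one_entry mat_zero_entry

lemma mat_in_carrierD:
  "\<lbrakk>A \<in> carrier (mat_ring n R); i \<in> {1..n}; j \<in> {1..n}\<rbrakk> \<Longrightarrow> A (i, j) \<in> carrier R"
  by (auto simp: mat_carrier)

lemma mat_eqI:
  assumes "A \<in> carrier (mat_ring n R)" "B \<in> carrier (mat_ring n R)"
    and "\<And>i j. i \<in> {1..n} \<Longrightarrow> j \<in> {1..n} \<Longrightarrow> A (i, j) = B (i, j)"
  shows "A = B"
  using assms unfolding mat_carrier by (intro PiE_ext) auto

context ring
begin

lemma mat_add_closed:
  "\<lbrakk>A \<in> carrier (mat_ring n R); B \<in> carrier (mat_ring n R)\<rbrakk> \<Longrightarrow>
    A \<oplus>\<^bsub>mat_ring n R\<^esub> B \<in> carrier (mat_ring n R)"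
  by (auto simp: mat_ring_def PiE_iff)

lemma mat_mult_closed:
  "\<lbrakk>A \<in> carrier (mat_ring n R); B \<in> carrier (mat_ring n R)\<rbrakk> \<Longrightarrow>
    A \<otimes>\<^bsub>mat_ring n R\<^esub> B \<in> carrier (mat_ring n R)"
  by (auto simp: mat_ring_def PiE_iff intro!: finsum_closed)

lemma mat_one_closed: "\<one>\<^bsub>mat_ring n R\<^esub> \<in> carrier (mat_ring n R)"
  by (auto simp: mat_ring_def)

lemma mat_zero_closed: "\<zero>\<^bsub>mat_ring n R\<^esub> \<in> carrier (mat_ring n R)"
  by (auto simp: mat_ring_def)

lemmas mat_closed = mat_add_closed mat_mult_closed mat_one_closed mat_zero_closed

lemma mat_mult_assoc:
  assumes A: "A \<in> carrier (mat_ring n R)" and B: "B \<in> carrier (mat_ring n R)"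
    and C: "C \<in> carrier (mat_ring n R)"
  shows "(A \<otimes>\<^bsub>mat_ring n R\<^esub> B) \<otimes>\<^bsub>mat_ring n R\<^esub> C = A \<otimes>\<^bsub>mat_ring n R\<^esub> (B \<otimes>\<^bsub>mat_ring n R\<^esub> C)"
    (is "?l = ?r")
proof (rule mat_eqI)
  fix i j assume ij: "i \<in> {1..n}" "j \<in> {1..n}"
  note D = mat_in_carrierD[OF A] mat_in_carrierD[OF B] mat_in_carrierD[OF C]
  have "?l (i, j) = (\<Oplus>k\<in>{1..n}. (\<Oplus>l\<in>{1..n}. A (i, l) \<otimes> B (l, k)) \<otimes> C (k, j))"
    using ij by (simp only: mat_mult_entry) (rule finsum_cong',
        auto simp: D mat_mult_entry Pi_def intro!: finsum_closed)
  also have "\<dots> = (\<Oplus>k\<in>{1..n}. \<Oplus>l\<in>{1..n}. A (i, l) \<otimes> B (l, k) \<otimes> C (k, j))"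
    using ij by (intro finsum_cong' finsum_ldistr) (auto simp: D Pi_def intro!: finsum_closed)
  also have "\<dots> = (\<Oplus>l\<in>{1..n}. \<Oplus>k\<in>{1..n}. A (i, l) \<otimes> B (l, k) \<otimes> C (k, j))"
    using ij by (intro finsum_exchange) (auto simp: D)
  also have "\<dots> = (\<Oplus>l\<in>{1..n}. \<Oplus>k\<in>{1..n}. A (i, l) \<otimes> (B (l, k) \<otimes> C (k, j)))"
    using ij by (intro finsum_cong') (auto simp: D Pi_def m_assoc intro!: finsum_closed)
  also have "\<dots> = (\<Oplus>l\<in>{1..n}. A (i, l) \<otimes> (\<Oplus>k\<in>{1..n}. B (l, k) \<otimes> C (k, j)))"
    using ij by (intro finsum_cong' finsum_rdistr[symmetric])
      (auto simp: D Pi_def intro!: finsum_closed)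
  also have "\<dots> = ?r (i, j)"
    using ij by (simp only: mat_mult_entry) (rule finsum_cong',
        auto simp: D mat_mult_entry Pi_def intro!: finsum_closed)
  finally show "?l (i, j) = ?r (i, j)" .
qed (use assms in \<open>auto intro: mat_mult_closed\<close>)

lemma mat_ring_is_ring: "ring (mat_ring n R)"
proof (rule ringI)
  show "abelian_group (mat_ring n R)"
  proof (rule abelian_groupI)
    fix A assume A: "A \<in> carrier (mat_ring n R)"
    let ?B = "\<lambda>(i, j)\<in>{1..n} \<times> {1..n}. \<ominus> A (i, j)"
    have B: "?B \<in> carrier (mat_ring n R)"
      using A by (auto simp: mat_carrier)
    have "?B \<oplus>\<^bsub>mat_ring n R\<^esub> A = \<zero>\<^bsub>mat_ring n R\<^esub>"
      by (rule mat_eqI) (use A B mat_in_carrierD[OF A] in \<open>auto simp: mat_entries l_neg intro: mat_closed\<close>)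
    with B show "\<exists>B\<in>carrier (mat_ring n R). B \<oplus>\<^bsub>mat_ring n R\<^esub> A = \<zero>\<^bsub>mat_ring n R\<^esub>"
      by blast
  next
    fix A B C
    assume "A \<in> carrier (mat_ring n R)" "B \<in> carrier (mat_ring n R)" "C \<in> carrier (mat_ring n R)"
    then show "A \<oplus>\<^bsub>mat_ring n R\<^esub> B \<oplus>\<^bsub>mat_ring n R\<^esub> C = A \<oplus>\<^bsub>mat_ring n R\<^esub> (B \<oplus>\<^bsub>mat_ring n R\<^esub> C)"
      by (intro mat_eqI[of _ n R]) (auto simp: mat_entries a_assoc mat_in_carrierD intro: mat_closed)
  next
    fix A B
    assume "A \<in> carrier (mat_ring n R)" "B \<in> carrier (mat_ring n R)"
    then show "A \<oplus>\<^bsub>mat_ring n R\<^esub> B = B \<oplus>\<^bsub>mat_ring n R\<^esub> A"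
      by (intro mat_eqI[of _ n R]) (auto simp: mat_entries a_comm mat_in_carrierD intro: mat_closed)
  next
    fix A
    assume "A \<in> carrier (mat_ring n R)"
    then show "\<zero>\<^bsub>mat_ring n R\<^esub> \<oplus>\<^bsub>mat_ring n R\<^esub> A = A"
      by (intro mat_eqI[of _ n R]) (auto simp: mat_entries mat_in_carrierD intro: mat_closed)
  qed (auto intro: mat_closed)
next
  show "monoid (mat_ring n R)"
  proof (rule monoidI)
    fix A assume A: "A \<in> carrier (mat_ring n R)"
    note D = mat_in_carrierD[OF A]
    show "\<one>\<^bsub>mat_ring n R\<^esub> \<otimes>\<^bsub>mat_ring n R\<^esub> A = A"
    proof (rule mat_eqI)
      fix i j assume ij: "i \<in> {1..n}" "j \<in> {1..n}"
      have "(\<Oplus>k\<in>{1..n}. \<one>\<^bsub>mat_ring n R\<^esub> (i, k) \<otimes> A (k, j)) = \<one>\<^bsub>mat_ring n R\<^esub> (i, i) \<otimes> A (i, j)"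
        using ij by (intro finsum_single_term) (auto simp: mat_one_entry D)
      then show "(\<one>\<^bsub>mat_ring n R\<^esub> \<otimes>\<^bsub>mat_ring n R\<^esub> A) (i, j) = A (i, j)"
        using ij by (simp add: mat_entries D)
    qed (use A in \<open>auto intro: mat_closed\<close>)
    show "A \<otimes>\<^bsub>mat_ring n R\<^esub> \<one>\<^bsub>mat_ring n R\<^esub> = A"
    proof (rule mat_eqI)
      fix i j assume ij: "i \<in> {1..n}" "j \<in> {1..n}"
      have "(\<Oplus>k\<in>{1..n}. A (i, k) \<otimes> \<one>\<^bsub>mat_ring n R\<^esub> (k, j)) = A (i, j) \<otimes> \<one>\<^bsub>mat_ring n R\<^esub> (j, j)"
        using ij by (intro finsum_single_term) (auto simp: mat_one_entry D)
      then show "(A \<otimes>\<^bsub>mat_ring n R\<^esub> \<one>\<^bsub>mat_ring n R\<^esub>) (i, j) = A (i, j)"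
        using ij by (simp add: mat_entries D)
    qed (use A in \<open>auto intro: mat_closed\<close>)
  qed (auto intro: mat_closed mat_mult_assoc)
next
  fix A B C
  assume A: "A \<in> carrier (mat_ring n R)" and B: "B \<in> carrier (mat_ring n R)"
    and C: "C \<in> carrier (mat_ring n R)"
  note D = mat_in_carrierD[OF A] mat_in_carrierD[OF B] mat_in_carrierD[OF C]
  show "(A \<oplus>\<^bsub>mat_ring n R\<^esub> B) \<otimes>\<^bsub>mat_ring n R\<^esub> C =
      A \<otimes>\<^bsub>mat_ring n R\<^esub> C \<oplus>\<^bsub>mat_ring n R\<^esub> B \<otimes>\<^bsub>mat_ring n R\<^esub> C"
  proof (rule mat_eqI)
    fix i j assume ij: "i \<in> {1..n}" "j \<in> {1..n}"
    have "(\<Oplus>k\<in>{1..n}. (A \<oplus>\<^bsub>mat_ring n R\<^esub> B) (i, k) \<otimes> C (k, j)) =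
        (\<Oplus>k\<in>{1..n}. A (i, k) \<otimes> C (k, j) \<oplus> B (i, k) \<otimes> C (k, j))"
      using ij by (intro finsum_cong') (auto simp: D mat_entries l_distr)
    also have "\<dots> = (\<Oplus>k\<in>{1..n}. A (i, k) \<otimes> C (k, j)) \<oplus> (\<Oplus>k\<in>{1..n}. B (i, k) \<otimes> C (k, j))"
      using ij by (intro finsum_addf) (auto simp: D)
    finally show "((A \<oplus>\<^bsub>mat_ring n R\<^esub> B) \<otimes>\<^bsub>mat_ring n R\<^esub> C) (i, j) =
        (A \<otimes>\<^bsub>mat_ring n R\<^esub> C \<oplus>\<^bsub>mat_ring n R\<^esub> B \<otimes>\<^bsub>mat_ring n R\<^esub> C) (i, j)"
      using ij by (simp only: mat_mult_entry mat_add_entry)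
  qed (use A B C in \<open>auto intro: mat_closed\<close>)
  show "C \<otimes>\<^bsub>mat_ring n R\<^esub> (A \<oplus>\<^bsub>mat_ring n R\<^esub> B) =
      C \<otimes>\<^bsub>mat_ring n R\<^esub> A \<oplus>\<^bsub>mat_ring n R\<^esub> C \<otimes>\<^bsub>mat_ring n R\<^esub> B"
  proof (rule mat_eqI)
    fix i j assume ij: "i \<in> {1..n}" "j \<in> {1..n}"
    have "(\<Oplus>k\<in>{1..n}. C (i, k) \<otimes> (A \<oplus>\<^bsub>mat_ring n R\<^esub> B) (k, j)) =
        (\<Oplus>k\<in>{1..n}. C (i, k) \<otimes> A (k, j) \<oplus> C (i, k) \<otimes> B (k, j))"
      using ij by (intro finsum_cong') (auto simp: D mat_entries r_distr)
    also have "\<dots> = (\<Oplus>k\<in>{1..n}. C (i, k) \<otimes> A (k, j)) \<oplus> (\<Oplus>k\<in>{1..n}. C (i, k) \<otimes> B (k, j))"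
      using ij by (intro finsum_addf) (auto simp: D)
    finally show "(C \<otimes>\<^bsub>mat_ring n R\<^esub> (A \<oplus>\<^bsub>mat_ring n R\<^esub> B)) (i, j) =
        (C \<otimes>\<^bsub>mat_ring n R\<^esub> A \<oplus>\<^bsub>mat_ring n R\<^esub> C \<otimes>\<^bsub>mat_ring n R\<^esub> B) (i, j)"
      using ij by (simp only: mat_mult_entry mat_add_entry)
  qed (use A B C in \<open>auto intro: mat_closed\<close>)
qed

lemma mat_minus_entry:
  assumes A: "A \<in> carrier (mat_ring n R)" and ij: "i \<in> {1..n}" "j \<in> {1..n}"
  shows "(\<ominus>\<^bsub>mat_ring n R\<^esub> A) (i, j) = \<ominus> A (i, j)"
proof -
  interpret M: ring "mat_ring n R"
    by (rule mat_ring_is_ring)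
  have "(\<ominus>\<^bsub>mat_ring n R\<^esub> A \<oplus>\<^bsub>mat_ring n R\<^esub> A) (i, j) = \<zero>"
    using A ij by (simp only: M.l_neg mat_zero_entry)
  then have "(\<ominus>\<^bsub>mat_ring n R\<^esub> A) (i, j) \<oplus> A (i, j) = \<zero>"
    using ij by (simp add: mat_add_entry)
  then show ?thesis
    using A ij by (intro minus_equality[symmetric]) (auto intro: mat_in_carrierD)
qed

end

locale incidence = ring R for R (structure) +
  fixes n :: nat and po :: "nat rel"
  assumes po: "partial_order_on {1..n} po"
begin

abbreviation inc ("\<A>") where "\<A> \<equiv> incidence_ring n po R"

lemma po_refl: "i \<in> {1..n} \<Longrightarrow> (i, i) \<in> po"
  using partial_order_onD(1)[OF po] by (simp add: refl_on_def)

lemma po_trans: "(i, j) \<in> po \<Longrightarrow> (j, k) \<in> po \<Longrightarrow> (i, k) \<in> po"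
  using partial_order_onD(2)[OF po] by (meson transD)

lemma po_antisym: "(i, j) \<in> po \<Longrightarrow> (j, i) \<in> po \<Longrightarrow> i = j"
  using partial_order_onD(3)[OF po] by (meson antisymD)

lemma po_range: "(i, j) \<in> po \<Longrightarrow> i \<in> {1..n} \<and> j \<in> {1..n}"
  using partial_order_onD(4)[OF po] by blast

lemma inc_carrier:
  "carrier \<A> = {A \<in> carrier (mat_ring n R).
     \<forall>i\<in>{1..n}. \<forall>j\<in>{1..n}. (i, j) \<notin> po \<longrightarrow> A (i, j) = \<zero>}"
  by (simp add: incidence_ring_def)

lemma inc_mat: "A \<in> carrier \<A> \<Longrightarrow> A \<in> carrier (mat_ring n R)"
  by (simp add: inc_carrier)

lemma inc_zero:
  "A \<in> carrier \<A> \<Longrightarrow> i \<in> {1..n} \<Longrightarrow> j \<in> {1..n} \<Longrightarrow> (i, j) \<notin> po \<Longrightarrow> A (i, j) = \<zero>"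
  by (simp add: inc_carrier)

lemma inc_in_carrier [simp]:
  "A \<in> carrier \<A> \<Longrightarrow> i \<in> {1..n} \<Longrightarrow> j \<in> {1..n} \<Longrightarrow> A (i, j) \<in> carrier R"
  by (rule mat_in_carrierD[OF inc_mat])

lemma inc_subring: "subring (carrier \<A>) (mat_ring n R)"
proof (rule ring.subringI[OF mat_ring_is_ring])
  interpret M: ring "mat_ring n R"
    by (rule mat_ring_is_ring)
  show "\<one>\<^bsub>mat_ring n R\<^esub> \<in> carrier \<A>"
    using po_refl by (auto simp: inc_carrier mat_entries mat_closed)
  fix A assume A: "A \<in> carrier \<A>"
  show "\<ominus>\<^bsub>mat_ring n R\<^esub> A \<in> carrier \<A>"
    using A by (auto simp: inc_carrier mat_minus_entry)
  fix B assume B: "B \<in> carrier \<A>"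
  show "A \<oplus>\<^bsub>mat_ring n R\<^esub> B \<in> carrier \<A>"
    using A B by (auto simp: inc_carrier mat_entries mat_closed)
  have "(A \<otimes>\<^bsub>mat_ring n R\<^esub> B) (i, j) = \<zero>"
    if ij: "i \<in> {1..n}" "j \<in> {1..n}" "(i, j) \<notin> po" for i j
  proof -
    have "A (i, k) \<otimes> B (k, j) = \<zero>" if "k \<in> {1..n}" for k
    proof (cases "(i, k) \<in> po")
      case True
      then have "B (k, j) = \<zero>"
        using ij that po_trans[of i k j] inc_zero[OF B, of k j] by auto
      then show ?thesis
        using A ij that by simp
    qed (use A B ij that inc_zero[OF A, of i k] in simp)
    then have "(\<Oplus>k\<in>{1..n}. A (i, k) \<otimes> B (k, j)) = (\<Oplus>k\<in>{1..n}. \<zero>)"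
      by (intro finsum_cong') auto
    then show ?thesis
      using ij by (simp add: mat_mult_entry)
  qed
  then show "A \<otimes>\<^bsub>mat_ring n R\<^esub> B \<in> carrier \<A>"
    using A B by (simp add: inc_carrier mat_closed)
qed (auto simp: inc_carrier)

lemma inc_eq: "\<A> = (mat_ring n R)\<lparr>carrier := carrier \<A>\<rparr>"
  by (simp add: incidence_ring_def)

lemma inc_ring: "ring \<A>"
  using ring.subring_is_ring[OF mat_ring_is_ring inc_subring] inc_eq by metis

lemma inc_ops:
  "add \<A> = add (mat_ring n R)" "monoid.mult \<A> = monoid.mult (mat_ring n R)"
  "\<one>\<^bsub>\<A>\<^esub> = \<one>\<^bsub>mat_ring n R\<^esub>" "\<zero>\<^bsub>\<A>\<^esub> = \<zero>\<^bsub>mat_ring n R\<^esub>"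
  by (simp_all add: incidence_ring_def)

lemma inc_add_entry:
  "\<lbrakk>i \<in> {1..n}; j \<in> {1..n}\<rbrakk> \<Longrightarrow> (A \<oplus>\<^bsub>\<A>\<^esub> B) (i, j) = A (i, j) \<oplus> B (i, j)"
  by (simp add: inc_ops mat_entries)

lemma inc_mult_entry:
  "\<lbrakk>i \<in> {1..n}; j \<in> {1..n}\<rbrakk> \<Longrightarrow>
    (A \<otimes>\<^bsub>\<A>\<^esub> B) (i, j) = (\<Oplus>k\<in>{1..n}. A (i, k) \<otimes> B (k, j))"
  by (simp add: inc_ops mat_entries)

lemma inc_one_entry:
  "\<lbrakk>i \<in> {1..n}; j \<in> {1..n}\<rbrakk> \<Longrightarrow> \<one>\<^bsub>\<A>\<^esub> (i, j) = (if i = j then \<one> else \<zero>)"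
  by (simp add: inc_ops mat_entries)

lemma inc_zero_entry: "\<lbrakk>i \<in> {1..n}; j \<in> {1..n}\<rbrakk> \<Longrightarrow> \<zero>\<^bsub>\<A>\<^esub> (i, j) = \<zero>"
  by (simp add: inc_ops mat_entries)

lemma inc_minus_entry:
  assumes A: "A \<in> carrier \<A>" and ij: "i \<in> {1..n}" "j \<in> {1..n}"
  shows "(\<ominus>\<^bsub>\<A>\<^esub> A) (i, j) = \<ominus> A (i, j)"
proof -
  interpret M: ring \<A>
    by (rule inc_ring)
  have "(\<ominus>\<^bsub>\<A>\<^esub> A \<oplus>\<^bsub>\<A>\<^esub> A) (i, j) = \<zero>"
    using A ij by (simp only: M.l_neg inc_zero_entry)
  then have "(\<ominus>\<^bsub>\<A>\<^esub> A) (i, j) \<oplus> A (i, j) = \<zero>"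
    using ij by (simp add: inc_add_entry)
  then show ?thesis
    using A ij by (intro minus_equality[symmetric]) (auto intro: mat_in_carrierD)
qed

lemma inc_eqI:
  assumes "A \<in> carrier \<A>" "B \<in> carrier \<A>"
    and "\<And>i j. i \<in> {1..n} \<Longrightarrow> j \<in> {1..n} \<Longrightarrow> A (i, j) = B (i, j)"
  shows "A = B"
  using assms by (intro mat_eqI[of A n R B]) (auto dest: inc_mat)

lemma inc_diag_mult:
  assumes A: "A \<in> carrier \<A>" and B: "B \<in> carrier \<A>" and i: "i \<in> {1..n}"
  shows "(A \<otimes>\<^bsub>\<A>\<^esub> B) (i, i) = A (i, i) \<otimes> B (i, i)"
proof -
  have "A (i, k) \<otimes> B (k, i) = \<zero>" if "k \<in> {1..n}" "k \<noteq> i" for k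
  proof (cases "(i, k) \<in> po")
    case True
    then have "B (k, i) = \<zero>"
      using i that po_antisym[of i k] inc_zero[OF B, of k i] by auto
    then show ?thesis
      using A i that by simp
  qed (use A B i that inc_zero[OF A, of i k] in simp)
  then have "(\<Oplus>k\<in>{1..n}. A (i, k) \<otimes> B (k, i)) = A (i, i) \<otimes> B (i, i)"
    using A B i by (intro finsum_single_term) auto
  then show ?thesis
    using i by (simp add: inc_mult_entry)
qed

text \<open>
  When nothing lies strictly between \<open>i\<close> and \<open>j\<close>, an entry of a product is the derivation-like
  two-term sum. Besides covers this includes the pairs with \<open>i\<close> not below \<open>j\<close>, where both sides vanish.
\<close>

lemma inc_offdiag_mult:
  assumes A: "A \<in> carrier \<A>" and B: "B \<in> carrier \<A>" and ij: "i \<in> {1..n}" "j \<in> {1..n}" "i \<noteq> j"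
    and no_mid: "\<not> (\<exists>k. strictly_below po i k \<and> strictly_below po k j)"
  shows "(A \<otimes>\<^bsub>\<A>\<^esub> B) (i, j) = A (i, i) \<otimes> B (i, j) \<oplus> A (i, j) \<otimes> B (j, j)"
proof -
  have "A (i, k) \<otimes> B (k, j) = \<zero>" if "k \<in> {1..n}" "k \<noteq> i" "k \<noteq> j" for k
  proof -
    have "(i, k) \<notin> po \<or> (k, j) \<notin> po"
      using no_mid that by (auto simp: strictly_below_def)
    then show ?thesis
      using A B ij that inc_zero[OF A, of i k] inc_zero[OF B, of k j] by auto
  qed
  then have "(\<Oplus>k\<in>{1..n}. A (i, k) \<otimes> B (k, j)) = A (i, i) \<otimes> B (i, j) \<oplus> A (i, j) \<otimes> B (j, j)"
    using A B ij by (intro finsum_two_terms) auto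
  then show ?thesis
    using ij by (simp add: inc_mult_entry)
qed

definition scalar_mat :: "'a \<Rightarrow> nat \<times> nat \<Rightarrow> 'a" where
  "scalar_mat r = (\<lambda>(i, j)\<in>{1..n} \<times> {1..n}. r \<otimes> \<one>\<^bsub>mat_ring n R\<^esub> (i, j))"

lemma scalar_matrices_eq: "scalar_matrices n R = scalar_mat ` carrier R"
  by (simp add: scalar_matrices_def scalar_mat_def)

lemma scalar_mat_entry:
  "\<lbrakk>r \<in> carrier R; i \<in> {1..n}; j \<in> {1..n}\<rbrakk> \<Longrightarrow> scalar_mat r (i, j) = (if i = j then r else \<zero>)"
  by (simp add: scalar_mat_def mat_entries)

lemma scalar_mat_closed: "r \<in> carrier R \<Longrightarrow> scalar_mat r \<in> carrier \<A>"
  using po_refl by (auto simp: inc_carrier scalar_mat_entry mat_carrier scalar_mat_def mat_one_entry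
      intro!: restrict_PiE[THEN iffD2])

lemma scalar_mult_entry:
  assumes r: "r \<in> carrier R" and A: "A \<in> carrier \<A>" and ij: "i \<in> {1..n}" "j \<in> {1..n}"
  shows "(scalar_mat r \<otimes>\<^bsub>\<A>\<^esub> A) (i, j) = r \<otimes> A (i, j)"
    and "(A \<otimes>\<^bsub>\<A>\<^esub> scalar_mat r) (i, j) = A (i, j) \<otimes> r"
proof -
  have "(\<Oplus>k\<in>{1..n}. scalar_mat r (i, k) \<otimes> A (k, j)) = scalar_mat r (i, i) \<otimes> A (i, j)"
    using r A ij by (intro finsum_single_term) (auto simp: scalar_mat_entry)
  then show "(scalar_mat r \<otimes>\<^bsub>\<A>\<^esub> A) (i, j) = r \<otimes> A (i, j)"
    using r ij by (simp add: inc_mult_entry scalar_mat_entry)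
  have "(\<Oplus>k\<in>{1..n}. A (i, k) \<otimes> scalar_mat r (k, j)) = A (i, j) \<otimes> scalar_mat r (j, j)"
    using r A ij by (intro finsum_single_term) (auto simp: scalar_mat_entry)
  then show "(A \<otimes>\<^bsub>\<A>\<^esub> scalar_mat r) (i, j) = A (i, j) \<otimes> r"
    using r ij by (simp add: inc_mult_entry scalar_mat_entry)
qed

end

section \<open>Subrings containing the scalar matrices\<close>

context incidence
begin

definition strict :: "nat rel" where
  "strict = {(i, j). strictly_below po i j}"

lemma strict_iff: "(i, j) \<in> strict \<longleftrightarrow> (i, j) \<in> po \<and> i \<noteq> j"
  by (simp add: strict_def strictly_below_def)

lemma strict_trans: "(i, j) \<in> strict \<Longrightarrow> (j, k) \<in> strict \<Longrightarrow> (i, k) \<in> strict"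
  unfolding strict_iff using po_trans po_antisym by metis

text \<open>
  By transitivity a chain can be shortened, so \<open>strict ^^ k\<close> decreases for \<open>k \<ge> 1\<close>. The powers
  therefore filter the strictly triangular part of the incidence ring by chain length; \<open>k = 0\<close>, where
  the relation is the diagonal, is the exception.
\<close>

lemma strict_pow_antimono: "strict ^^ Suc (Suc k) \<subseteq> strict ^^ Suc k"
proof -
  have "strict O strict \<subseteq> strict"
    using strict_trans by blast
  then have "strict ^^ k O (strict O strict) \<subseteq> strict ^^ k O strict"
    by (rule relcomp_mono[OF subset_refl])
  then show ?thesis
    by (simp add: O_assoc)
qed

lemma strict_pow_subset: "strict ^^ Suc k \<subseteq> strict"
proof (induction k)
  case (Suc k)
  then show ?case
    using strict_pow_antimono by blast
qed simp

text \<open>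
  Along a strict step the number of elements below grows, and it never exceeds \<open>n\<close>.
\<close>

lemma strict_pow_empty: "strict ^^ Suc n = {}"
proof -
  define down where "down i = {x. (x, i) \<in> po}" for i
  have fin: "finite (down i)" and le: "card (down i) \<le> n" for i
  proof -
    have sub: "down i \<subseteq> {1..n}"
      using po_range by (auto simp: down_def)
    then show "finite (down i)"
      by (rule finite_subset) simp
    show "card (down i) \<le> n"
      using card_mono[OF _ sub] by simp
  qed
  have lt: "card (down i) < card (down j)" if "(i, j) \<in> strict" for i j
  proof (rule psubset_card_mono[OF fin])
    have "(i, j) \<in> po" "i \<noteq> j"
      using that by (auto simp: strict_iff)
    then show "down i \<subset> down j"
      using po_trans po_antisym po_refl po_range unfolding down_def by blast
  qed
  have grow: "card (down i) + k \<le> card (down j)" if "(i, j) \<in> strict ^^ k" for i j k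
    using that
  proof (induction k arbitrary: j)
    case (Suc k)
    then obtain l where "(i, l) \<in> strict ^^ k" "(l, j) \<in> strict"
      by auto
    then show ?case
      using Suc.IH lt by fastforce
  qed simp
  have "(i, j) \<notin> strict ^^ Suc n" for i j
  proof
    assume "(i, j) \<in> strict ^^ Suc n"
    then have "card (down i) + Suc n \<le> card (down j)"
      by (rule grow)
    then show False
      using le[of j] by simp
  qed
  then show ?thesis
    by auto
qed

end

locale scalar_subring = incidence +
  fixes S :: "(nat \<times> nat \<Rightarrow> 'a) set"
  assumes sub: "subring S \<A>" and scalars: "scalar_matrices n R \<subseteq> S"
begin

sublocale inc: ring \<A>
  by (rule inc_ring)

lemma S_carrier: "A \<in> S \<Longrightarrow> A \<in> carrier \<A>"
  using subringE(1)[OF sub] by blast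

lemmas S_mult = subringE(6)[OF sub]
lemmas S_add = subringE(7)[OF sub]

lemma S_diff: "A \<in> S \<Longrightarrow> B \<in> S \<Longrightarrow> A \<ominus>\<^bsub>\<A>\<^esub> B \<in> S"
  using S_add subringE(5)[OF sub] by (simp add: a_minus_def)

lemma S_zero: "\<zero>\<^bsub>\<A>\<^esub> \<in> S"
  using subringE(2)[OF sub] .

lemma S_one: "\<one>\<^bsub>\<A>\<^esub> \<in> S"
  using subringE(3)[OF sub] .

lemma S_scalar: "r \<in> carrier R \<Longrightarrow> scalar_mat r \<in> S"
  using scalars by (auto simp: scalar_matrices_eq)

lemma diff_entry:
  "\<lbrakk>A \<in> carrier \<A>; B \<in> carrier \<A>; i \<in> {1..n}; j \<in> {1..n}\<rbrakk> \<Longrightarrow>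
    (A \<ominus>\<^bsub>\<A>\<^esub> B) (i, j) = A (i, j) \<ominus> B (i, j)"
  by (simp add: a_minus_def inc_add_entry inc_minus_entry)

lemma S_entry [simp]:
  "A \<in> S \<Longrightarrow> i \<in> {1..n} \<Longrightarrow> j \<in> {1..n} \<Longrightarrow> A (i, j) \<in> carrier R"
  using inc_in_carrier S_carrier by blast

text \<open>
  Diagonals multiply entrywise, so the product over \<open>j \<noteq> i\<close> of the members that separate \<open>i\<close> from \<open>j\<close>
  has the diagonal of the matrix unit at \<open>(i, i)\<close>.
\<close>

lemma diagonal_unit_in_S:
  assumes sep: "\<And>i j. \<lbrakk>i \<in> {1..n}; j \<in> {1..n}; i \<noteq> j\<rbrakk> \<Longrightarrow>
      \<exists>A\<in>S. A (i, i) = \<one> \<and> A (j, j) = \<zero>"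
    and i: "i \<in> {1..n}"
  shows "\<exists>A\<in>S. \<forall>j\<in>{1..n}. A (j, j) = (if j = i then \<one> else \<zero>)"
proof -
  have "\<exists>A\<in>S. A (i, i) = \<one> \<and> (\<forall>j\<in>T. A (j, j) = \<zero>)" if "finite T" "T \<subseteq> {1..n} - {i}" for T
    using that
  proof (induction T rule: finite_induct)
    case empty
    have "\<one>\<^bsub>\<A>\<^esub> (i, i) = \<one>"
      using i by (simp add: inc_one_entry)
    then show ?case
      using S_one by blast
  next
    case (insert j T)
    then obtain A where A: "A \<in> S" "A (i, i) = \<one>" "\<forall>j\<in>T. A (j, j) = \<zero>"
      by auto
    obtain B where B: "B \<in> S" "B (i, i) = \<one>" "B (j, j) = \<zero>"
      using sep[of i j] i insert.prems by auto
    have T: "l \<in> {1..n}" if "l \<in> insert j T" for l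
      using insert.prems that by blast
    have diag: "(A \<otimes>\<^bsub>\<A>\<^esub> B) (l, l) = A (l, l) \<otimes> B (l, l)" if "l \<in> {1..n}" for l
      using inc_diag_mult A B that S_carrier by blast
    show ?case
    proof (intro bexI conjI ballI)
      show "A \<otimes>\<^bsub>\<A>\<^esub> B \<in> S"
        using A B S_mult by blast
      show "(A \<otimes>\<^bsub>\<A>\<^esub> B) (i, i) = \<one>"
        using diag[OF i] A B by simp
      fix l assume l: "l \<in> insert j T"
      show "(A \<otimes>\<^bsub>\<A>\<^esub> B) (l, l) = \<zero>"
      proof (cases "l = j")
        case True
        then show ?thesis
          using diag[OF T[OF l]] A(1) B T[OF l] by simp
      next
        case False
        then show ?thesis
          using diag[OF T[OF l]] A B(1) l T[OF l] by simp
      qed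
    qed
  qed
  from this[of "{1..n} - {i}"] obtain A
    where "A \<in> S" "A (i, i) = \<one>" "\<forall>j\<in>{1..n} - {i}. A (j, j) = \<zero>"
    by auto
  then show ?thesis
    by (intro bexI[of _ A]) auto
qed

text \<open>
  The base case of the chain argument, chains of length one. At a cover the given member is multiplied
  on both sides by members with the diagonals of the matrix units at \<open>i\<close> and \<open>j\<close>; modulo longer chains
  this keeps only the \<open>(i, j)\<close> entry. A pair that is not a cover is itself joined by a chain of length
  two, so the claim says nothing about its entry and the zero matrix serves.
\<close>

lemma cover_unit_in_S:
  assumes sep: "\<And>i j. \<lbrakk>i \<in> {1..n}; j \<in> {1..n}; i \<noteq> j\<rbrakk> \<Longrightarrow>
      \<exists>A\<in>S. A (i, i) = \<one> \<and> A (j, j) = \<zero>"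
    and cover: "\<And>i j. covered_by po i j \<Longrightarrow>
      \<exists>A\<in>S. A (i, j) = \<one> \<and> A (i, i) = \<zero> \<and> A (j, j) = \<zero>"
    and ij: "(i, j) \<in> strict"
  shows "\<exists>A\<in>S. \<forall>u\<in>{1..n}. \<forall>v\<in>{1..n}.
    (u, v) \<notin> strict ^^ 2 \<longrightarrow> A (u, v) = (if (u, v) = (i, j) then \<one> else \<zero>)"
proof (cases "covered_by po i j")
  case False
  then have "(i, j) \<in> strict ^^ 2"
    using ij by (auto simp: covered_by_def strict_def numeral_2_eq_2 relcomp_unfold)
  then show ?thesis
    using S_zero by (intro bexI[of _ "\<zero>\<^bsub>\<A>\<^esub>"]) (auto simp: inc_zero_entry)
next
  case True
  have i: "i \<in> {1..n}" and j: "j \<in> {1..n}" and neq: "i \<noteq> j"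
    using ij po_range by (auto simp: strict_iff)
  obtain D where D: "D \<in> S" "\<forall>u\<in>{1..n}. D (u, u) = (if u = i then \<one> else \<zero>)"
    using diagonal_unit_in_S[OF sep i] by blast
  obtain E where E: "E \<in> S" "\<forall>u\<in>{1..n}. E (u, u) = (if u = j then \<one> else \<zero>)"
    using diagonal_unit_in_S[OF sep j] by blast
  obtain A where A: "A \<in> S" "A (i, j) = \<one>" "A (i, i) = \<zero>" "A (j, j) = \<zero>"
    using cover[OF True] by blast
  define Z where "Z = D \<otimes>\<^bsub>\<A>\<^esub> A"
  have Z: "Z \<in> S"
    using D A S_mult unfolding Z_def by blast
  have Zdiag: "Z (u, u) = \<zero>" if "u \<in> {1..n}" for u
    using inc_diag_mult[OF S_carrier[OF D(1)] S_carrier[OF A(1)] that] D A that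
    by (cases "u = i") (auto simp: Z_def)
  have "(Z \<otimes>\<^bsub>\<A>\<^esub> E) (u, v) = (if (u, v) = (i, j) then \<one> else \<zero>)"
    if uv: "u \<in> {1..n}" "v \<in> {1..n}" "(u, v) \<notin> strict ^^ 2" for u v
  proof (cases "u = v")
    case True
    then show ?thesis
      using inc_diag_mult[OF S_carrier[OF Z] S_carrier[OF E(1)] uv(1)] Zdiag uv neq E by auto
  next
    case False
    have no_mid: "\<not> (\<exists>k. strictly_below po u k \<and> strictly_below po k v)"
      using uv(3) by (auto simp: strict_def numeral_2_eq_2 relcomp_unfold)
    have "(Z \<otimes>\<^bsub>\<A>\<^esub> E) (u, v) = Z (u, u) \<otimes> E (u, v) \<oplus> Z (u, v) \<otimes> E (v, v)"
      by (rule inc_offdiag_mult[OF S_carrier[OF Z] S_carrier[OF E(1)] uv(1,2) False no_mid])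
    also have "\<dots> = Z (u, v) \<otimes> E (v, v)"
      using Z E(1) uv by (simp add: Zdiag)
    finally have 1: "(Z \<otimes>\<^bsub>\<A>\<^esub> E) (u, v) = Z (u, v) \<otimes> E (v, v)" .
    have 2: "Z (u, v) = D (u, u) \<otimes> A (u, v) \<oplus> D (u, v) \<otimes> A (v, v)"
      unfolding Z_def
      by (rule inc_offdiag_mult[OF S_carrier[OF D(1)] S_carrier[OF A(1)] uv(1,2) False no_mid])
    show ?thesis
    proof (cases "v = j")
      case True
      then show ?thesis
        using 1 2 D E A uv j by (cases "u = i") auto
    next
      case False
      then show ?thesis
        using 1 E Z uv by auto
    qed
  qed
  moreover have "Z \<otimes>\<^bsub>\<A>\<^esub> E \<in> S"
    using Z E S_mult by blast
  ultimately show ?thesis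
    by blast
qed

text \<open>
  Matrix units up to longer chains: a unit for a chain of length \<open>k\<close> times a unit for one more step is
  one for length \<open>k + 1\<close>, since the error terms of the product sit on chains of length at least \<open>k + 2\<close>.
\<close>

lemma leading_unit_in_S:
  assumes sep: "\<And>i j. \<lbrakk>i \<in> {1..n}; j \<in> {1..n}; i \<noteq> j\<rbrakk> \<Longrightarrow>
      \<exists>A\<in>S. A (i, i) = \<one> \<and> A (j, j) = \<zero>"
    and cover: "\<And>i j. covered_by po i j \<Longrightarrow>
      \<exists>A\<in>S. A (i, j) = \<one> \<and> A (i, i) = \<zero> \<and> A (j, j) = \<zero>"
    and ij: "i \<in> {1..n}" "(i, j) \<in> strict ^^ k"
  shows "\<exists>A\<in>S. \<forall>u\<in>{1..n}. \<forall>v\<in>{1..n}.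
    (u, v) \<notin> strict ^^ Suc k \<longrightarrow> A (u, v) = (if (u, v) = (i, j) then \<one> else \<zero>)"
  using ij(2)
proof (induction k arbitrary: j)
  case 0
  obtain A where A: "A \<in> S" "\<forall>u\<in>{1..n}. A (u, u) = (if u = i then \<one> else \<zero>)"
    using diagonal_unit_in_S[OF sep ij(1)] by blast
  have off: "A (u, v) = \<zero>" if "u \<in> {1..n}" "v \<in> {1..n}" "(u, v) \<notin> strict" "u \<noteq> v" for u v
    using inc_zero[OF S_carrier[OF A(1)] that(1,2)] that by (simp add: strict_iff)
  show ?case
  proof (intro bexI[of _ A] ballI impI)
    fix u v assume "u \<in> {1..n}" "v \<in> {1..n}" "(u, v) \<notin> strict ^^ Suc 0"
    then show "A (u, v) = (if (u, v) = (i, j) then \<one> else \<zero>)"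
      using A 0 off[of u v] by (cases "u = v") auto
  qed (rule A(1))
next
  case (Suc k)
  then obtain l where l: "(i, l) \<in> strict ^^ k" "(l, j) \<in> strict"
    by auto
  then have lr: "l \<in> {1..n}"
    using po_range by (auto simp: strict_iff)
  obtain A where A: "A \<in> S" and Ae: "\<And>u v. \<lbrakk>u \<in> {1..n}; v \<in> {1..n}; (u, v) \<notin> strict ^^ Suc k\<rbrakk> \<Longrightarrow>
      A (u, v) = (if (u, v) = (i, l) then \<one> else \<zero>)"
    using Suc.IH[OF l(1)] by blast
  obtain B where B: "B \<in> S" and Be: "\<And>u v. \<lbrakk>u \<in> {1..n}; v \<in> {1..n}; (u, v) \<notin> strict ^^ 2\<rbrakk> \<Longrightarrow>
      B (u, v) = (if (u, v) = (l, j) then \<one> else \<zero>)"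
    using cover_unit_in_S[OF sep cover l(2)] by blast
  have "(A \<otimes>\<^bsub>\<A>\<^esub> B) (u, v) = (if (u, v) = (i, j) then \<one> else \<zero>)"
    if uv: "u \<in> {1..n}" "v \<in> {1..n}" "(u, v) \<notin> strict ^^ Suc (Suc k)" for u v
  proof -
    have comp1: "(u, w) \<in> strict ^^ Suc k \<Longrightarrow> (w, v) \<notin> strict" for w
      using uv(3) by auto
    have comp2: "(u, w) \<in> strict ^^ k \<Longrightarrow> (w, v) \<notin> strict ^^ 2" for w
    proof
      assume "(u, w) \<in> strict ^^ k" "(w, v) \<in> strict ^^ 2"
      then have "(u, v) \<in> strict ^^ (k + 2)"
        unfolding relpow_add by blast
      then show False
        using uv(3) by simp
    qed
    have comp3: "(u, w) \<in> strict ^^ Suc k \<Longrightarrow> (w, v) \<notin> strict ^^ 2" for w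
      using comp1 strict_pow_subset[of 1] by (auto simp: numeral_2_eq_2 simp del: relpow.simps)
    have off: "A (u, w) \<otimes> B (w, v) = \<zero>" if w: "w \<in> {1..n}" "w \<noteq> l" for w
    proof (cases "(u, w) \<in> strict ^^ Suc k")
      case True
      then have "B (w, v) = \<zero>"
        using comp3 Be[of w v] w uv by auto
      then show ?thesis
        using A w uv by simp
    next
      case False
      then have "A (u, w) = \<zero>"
        using Ae[of u w] w uv by auto
      then show ?thesis
        using B w uv by simp
    qed
    have "(A \<otimes>\<^bsub>\<A>\<^esub> B) (u, v) = A (u, l) \<otimes> B (l, v)"
      using off A B uv lr by (simp only: inc_mult_entry) (rule finsum_single_term, auto)
    also have "\<dots> = (if (u, v) = (i, j) then \<one> else \<zero>)"
    proof (cases "u = i")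
      case True
      then have Bl: "B (l, v) = (if v = j then \<one> else \<zero>)"
        using comp2[of l] l Be[of l v] lr uv by auto
      show ?thesis
      proof (cases "v = j")
        case v: True
        then have "(u, l) \<notin> strict ^^ Suc k"
          using comp1[of l] l by auto
        then show ?thesis
          using Ae[of u l] Bl uv lr True v by simp
      next
        case False
        then show ?thesis
          using Bl A uv lr by simp
      qed
    next
      case u: False
      show ?thesis
      proof (cases "(u, l) \<in> strict ^^ Suc k")
        case True
        have "v \<noteq> j"
          using comp1[OF True] l by auto
        then have "B (l, v) = \<zero>"
          using Be[of l v] comp3[OF True] lr uv by auto
        then show ?thesis
          using u A uv lr by simp
      next
        case False
        then show ?thesis
          using Ae[of u l] u B uv lr by simp
      qed
    qed
    finally show ?thesis .
  qed
  then show ?case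
    using S_mult[OF A B] by (intro bexI[of _ "A \<otimes>\<^bsub>\<A>\<^esub> B"]) blast+
qed

text \<open>
  Downward induction on the chain length that supports a matrix: subtracting scalar multiples of the
  leading units pushes the support to longer chains, until nothing is left.
\<close>

lemma subring_is_everything:
  assumes sep: "\<And>i j. \<lbrakk>i \<in> {1..n}; j \<in> {1..n}; i \<noteq> j\<rbrakk> \<Longrightarrow>
      \<exists>A\<in>S. A (i, i) = \<one> \<and> A (j, j) = \<zero>"
    and cover: "\<And>i j. covered_by po i j \<Longrightarrow>
      \<exists>A\<in>S. A (i, j) = \<one> \<and> A (i, i) = \<zero> \<and> A (j, j) = \<zero>"
  shows "S = carrier \<A>"
proof -
  \<comment> \<open>The second power matters only for \<open>k = 0\<close>, where it makes the level all of \<open>po\<close>.\<close>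
  define level where "level k = strict ^^ k \<union> strict ^^ Suc k" for k
  have descend: "A \<in> S"
    if next_level: "\<And>A. \<lbrakk>A \<in> carrier \<A>; \<forall>u\<in>{1..n}. \<forall>v\<in>{1..n}. (u, v) \<notin> level (Suc k) \<longrightarrow> A (u, v) = \<zero>\<rbrakk> \<Longrightarrow> A \<in> S"
      and A: "A \<in> carrier \<A>" "\<forall>u\<in>{1..n}. \<forall>v\<in>{1..n}. (u, v) \<notin> level k \<longrightarrow> A (u, v) = \<zero>"
    for k A
    using A
  proof (induction "card {(u, v) \<in> {1..n} \<times> {1..n}. (u, v) \<notin> strict ^^ Suc k \<and> A (u, v) \<noteq> \<zero>}"
      arbitrary: A rule: less_induct)
    case less
    define bad where "bad A = {(u, v) \<in> {1..n} \<times> {1..n}. (u, v) \<notin> strict ^^ Suc k \<and> A (u, v) \<noteq> \<zero>}"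
      for A :: "nat \<times> nat \<Rightarrow> 'a"
    have fin: "finite (bad A)"
      by (rule finite_subset[of _ "{1..n} \<times> {1..n}"]) (auto simp: bad_def)
    show ?case
    proof (cases "bad A = {}")
      case True
      then show ?thesis
      proof (intro next_level less.prems(1) ballI impI)
        fix u v assume uv: "u \<in> {1..n}" "v \<in> {1..n}" "(u, v) \<notin> level (Suc k)"
        then have "(u, v) \<notin> strict ^^ Suc k"
          by (simp add: level_def)
        then show "A (u, v) = \<zero>"
          using True uv unfolding bad_def by blast
      qed
    next
      case False
      then obtain i j where ij: "(i, j) \<in> bad A"
        by auto
      then have range: "i \<in> {1..n}" "j \<in> {1..n}" and notin: "(i, j) \<notin> strict ^^ Suc k"
        and nz: "A (i, j) \<noteq> \<zero>"
        by (auto simp: bad_def)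
      have lev: "(i, j) \<in> strict ^^ k"
        using less.prems(2) range nz notin unfolding level_def by blast
      obtain G where G: "G \<in> S" and Ge: "\<And>u v. \<lbrakk>u \<in> {1..n}; v \<in> {1..n}; (u, v) \<notin> strict ^^ Suc k\<rbrakk> \<Longrightarrow>
          G (u, v) = (if (u, v) = (i, j) then \<one> else \<zero>)"
        using leading_unit_in_S[OF sep cover range(1) lev] by blast
      define H where "H = scalar_mat (A (i, j)) \<otimes>\<^bsub>\<A>\<^esub> G"
      have Aij: "A (i, j) \<in> carrier R"
        using less.prems range by simp
      have H: "H \<in> S"
        using S_mult[OF S_scalar[OF Aij] G] by (simp add: H_def)
      have He: "H (u, v) = (if (u, v) = (i, j) then A (i, j) else \<zero>)"
        if "u \<in> {1..n}" "v \<in> {1..n}" "(u, v) \<notin> strict ^^ Suc k" for u v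
        using scalar_mult_entry(1)[OF Aij S_carrier[OF G] that(1,2)] Ge[OF that] Aij
        by (simp add: H_def)
      define B where "B = A \<ominus>\<^bsub>\<A>\<^esub> H"
      have B: "B \<in> carrier \<A>"
        using less.prems S_carrier[OF H] by (simp add: B_def)
      have Be: "B (u, v) = (if (u, v) = (i, j) then \<zero> else A (u, v))"
        if uv: "u \<in> {1..n}" "v \<in> {1..n}" "(u, v) \<notin> strict ^^ Suc k" for u v
        using diff_entry[OF less.prems(1) S_carrier[OF H] uv(1,2)] He[OF uv] Aij
          inc_in_carrier[OF less.prems(1) uv(1,2)] by (auto simp: B_def r_neg a_minus_def)
      have "bad B \<subseteq> bad A - {(i, j)}"
        using Be by (auto simp: bad_def split: if_splits)
      then have "card (bad B) < card (bad A)"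
        using ij fin by (metis card_Diff1_less card_mono finite_Diff le_less_trans)
      moreover have "\<forall>u\<in>{1..n}. \<forall>v\<in>{1..n}. (u, v) \<notin> level k \<longrightarrow> B (u, v) = \<zero>"
        using Be less.prems(2) by (auto simp: level_def)
      ultimately have "B \<in> S"
        using less.hyps[of B] B by (simp add: bad_def)
      moreover have "A = B \<oplus>\<^bsub>\<A>\<^esub> H"
        using less.prems(1) S_carrier[OF H] unfolding B_def
        by (simp add: a_minus_def inc.a_assoc inc.l_neg)
      ultimately show ?thesis
        using S_add[OF _ H] by simp
    qed
  qed
  have all: "A \<in> S"
    if "k \<le> Suc n" "A \<in> carrier \<A>" "\<forall>u\<in>{1..n}. \<forall>v\<in>{1..n}. (u, v) \<notin> level k \<longrightarrow> A (u, v) = \<zero>"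
    for k A
    using that
  proof (induction k arbitrary: A rule: inc_induct)
    case base
    have "level (Suc n) = {}"
      using strict_pow_empty strict_pow_antimono[of n] by (auto simp: level_def simp del: relpow.simps)
    then have "A = \<zero>\<^bsub>\<A>\<^esub>"
      using base by (intro inc_eqI) (auto simp: inc_zero_entry)
    then show ?case
      using S_zero by simp
  next
    case (step k)
    then show ?case
      by (intro descend[of k A]) blast+
  qed
  have "A \<in> S" if A: "A \<in> carrier \<A>" for A
  proof (rule all[of 0])
    show "\<forall>u\<in>{1..n}. \<forall>v\<in>{1..n}. (u, v) \<notin> level 0 \<longrightarrow> A (u, v) = \<zero>"
      using inc_zero[OF A] by (auto simp: level_def strict_iff)
  qed (use A in auto)
  then show ?thesis
    using S_carrier by blast
qed

end

section \<open>The generation criterion\<close>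

definition ring_center :: "('a, 'b) ring_scheme \<Rightarrow> 'a set" where
  "ring_center T = {z \<in> carrier T. \<forall>x\<in>carrier T. x \<otimes>\<^bsub>T\<^esub> z = z \<otimes>\<^bsub>T\<^esub> x}"

lemma (in ring_hom_ring) hom_diff [simp]:
  "x \<in> carrier R \<Longrightarrow> y \<in> carrier R \<Longrightarrow> h (x \<ominus> y) = h x \<ominus>\<^bsub>S\<^esub> h y"
  by (simp add: R.minus_eq S.minus_eq)

text \<open>
  Multiplying by a scalar matrix on the left or on the right multiplies every entry on that side, so
  the set absorbs \<open>R\<close> on both sides, although \<open>S\<close> is only a subring.
\<close>

lemma (in scalar_subring) entry_ideal:
  assumes p: "p \<in> {1..n} \<times> {1..n}" and Q: "Q \<subseteq> {1..n} \<times> {1..n}"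
  shows "ideal ((\<lambda>A. A p) ` {A \<in> S. \<forall>q\<in>Q. A q = \<zero>}) R" (is "ideal ?I R")
proof (rule idealI)
  obtain i j where ij: "p = (i, j)" "i \<in> {1..n}" "j \<in> {1..n}"
    using p by auto
  have Qe: "A q \<in> carrier R" if "A \<in> S" "q \<in> Q" for A q
    using Q that by (cases q) auto
  show "ring R"
    by (rule ring_axioms)
  show "subgroup ?I (add_monoid R)"
  proof (rule add.subgroupI)
    show "?I \<subseteq> carrier R"
      using ij by auto
    have "\<zero>\<^bsub>\<A>\<^esub> q = \<zero>" if "q \<in> Q" for q
      using Q that by (cases q) (auto simp: inc_zero_entry)
    then show "?I \<noteq> {}"
      using S_zero by blast
    fix a assume "a \<in> ?I"
    then obtain A where A: "A \<in> S" "\<forall>q\<in>Q. A q = \<zero>" "a = A p"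
      by blast
    have "(\<ominus>\<^bsub>\<A>\<^esub> A) q = \<zero>" if "q \<in> Q" for q
      using Q that A(2) S_carrier[OF A(1)] by (cases q) (auto simp: inc_minus_entry)
    moreover have "(\<ominus>\<^bsub>\<A>\<^esub> A) p = \<ominus> a"
      using S_carrier[OF A(1)] A(3) ij by (simp add: inc_minus_entry)
    ultimately show "\<ominus> a \<in> ?I"
      using subringE(5)[OF sub A(1)] by (intro image_eqI[of _ _ "\<ominus>\<^bsub>\<A>\<^esub> A"]) auto
    fix b assume "b \<in> ?I"
    then obtain B where B: "B \<in> S" "\<forall>q\<in>Q. B q = \<zero>" "b = B p"
      by blast
    have "(A \<oplus>\<^bsub>\<A>\<^esub> B) q = \<zero>" if "q \<in> Q" for q
      using Q that A(2) B(2) by (cases q) (auto simp: inc_add_entry)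
    moreover have "(A \<oplus>\<^bsub>\<A>\<^esub> B) p = a \<oplus> b"
      using A(3) B(3) ij by (simp add: inc_add_entry)
    ultimately show "a \<oplus> b \<in> ?I"
      using S_add[OF A(1) B(1)] by (intro image_eqI[of _ _ "A \<oplus>\<^bsub>\<A>\<^esub> B"]) auto
  qed
  fix a r assume "a \<in> ?I" and r: "r \<in> carrier R"
  then obtain A where A: "A \<in> S" "\<forall>q\<in>Q. A q = \<zero>" "a = A p"
    by blast
  have "(scalar_mat r \<otimes>\<^bsub>\<A>\<^esub> A) q = \<zero>" "(A \<otimes>\<^bsub>\<A>\<^esub> scalar_mat r) q = \<zero>" if "q \<in> Q" for q
    using Q that A(2) r S_carrier[OF A(1)] by (cases q, auto simp: scalar_mult_entry)+
  moreover have "(scalar_mat r \<otimes>\<^bsub>\<A>\<^esub> A) p = r \<otimes> a" "(A \<otimes>\<^bsub>\<A>\<^esub> scalar_mat r) p = a \<otimes> r"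
    using S_carrier[OF A(1)] A(3) ij r by (simp_all add: scalar_mult_entry)
  ultimately show "r \<otimes> a \<in> ?I" "a \<otimes> r \<in> ?I"
    using S_mult[OF S_scalar[OF r] A(1)] S_mult[OF A(1) S_scalar[OF r]]
    by (auto intro: image_eqI[of _ _ "scalar_mat r \<otimes>\<^bsub>\<A>\<^esub> A"] image_eqI[of _ _ "A \<otimes>\<^bsub>\<A>\<^esub> scalar_mat r"])
qed

context incidence
begin

text \<open>
  The generation criterion at one quotient \<open>\<phi> : R \<rightarrow> T\<close>. Its second half says that the \<open>(i, j)\<close> entry, which
  is a derivation at a cover, does not agree on \<open>G\<close> with an inner derivation by a central element.
\<close>

definition separates :: "(nat \<times> nat \<Rightarrow> 'a) set \<Rightarrow> ('c, 'd) ring_scheme \<Rightarrow> ('a \<Rightarrow> 'c) \<Rightarrow> bool" where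
  "separates G T \<phi> \<longleftrightarrow>
     (\<forall>i\<in>{1..n}. \<forall>j\<in>{1..n}. i \<noteq> j \<longrightarrow> (\<exists>A\<in>G. \<phi> (A (i, i)) \<noteq> \<phi> (A (j, j)))) \<and>
     (\<forall>i j. covered_by po i j \<longrightarrow> (\<forall>z\<in>ring_center T.
        \<exists>A\<in>G. \<phi> (A (i, j)) \<noteq> (\<phi> (A (i, i)) \<ominus>\<^bsub>T\<^esub> \<phi> (A (j, j))) \<otimes>\<^bsub>T\<^esub> z))"

lemma cover_facts:
  assumes "covered_by po i j"
  shows "i \<in> {1..n}" "j \<in> {1..n}" "i \<noteq> j" "(i, j) \<in> po"
    "\<not> (\<exists>k. strictly_below po i k \<and> strictly_below po k j)"
  using assms po_range by (auto simp: covered_by_def strictly_below_def)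

lemma equal_diagonal_subring:
  assumes T: "ring T" and \<phi>: "\<phi> \<in> ring_hom R T" and ij: "i \<in> {1..n}" "j \<in> {1..n}"
  shows "subring {A \<in> carrier \<A>. \<phi> (A (i, i)) = \<phi> (A (j, j))} \<A>" (is "subring ?H _")
proof -
  interpret inc: ring \<A>
    by (rule inc_ring)
  interpret \<phi>: ring_hom_ring R T \<phi>
    using T \<phi> ring_axioms by (intro ring_hom_ringI2)
  show ?thesis
    using ij by (intro inc.subringI)
      (auto simp: inc_one_entry inc_minus_entry inc_diag_mult inc_add_entry)
qed

text \<open>
  For products, \<open>a\<^sub>1 (b\<^sub>1 - b\<^sub>2) z + (a\<^sub>1 - a\<^sub>2) z b\<^sub>2 = (a\<^sub>1 b\<^sub>1 - a\<^sub>2 b\<^sub>2) z\<close>, as \<open>z\<close> is central: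
  the difference of the diagonal entries times \<open>z\<close> is an inner derivation, as the \<open>(i, j)\<close> entry is a
  derivation.
\<close>

lemma proportional_cover_subring:
  assumes T: "ring T" and \<phi>: "\<phi> \<in> ring_hom R T" and cov: "covered_by po i j"
    and z: "z \<in> ring_center T"
  shows "subring {A \<in> carrier \<A>. \<phi> (A (i, j)) = (\<phi> (A (i, i)) \<ominus>\<^bsub>T\<^esub> \<phi> (A (j, j))) \<otimes>\<^bsub>T\<^esub> z} \<A>"
    (is "subring ?H _")
proof -
  interpret inc: ring \<A>
    by (rule inc_ring)
  interpret T: ring T
    by (rule T)
  interpret \<phi>: ring_hom_ring R T \<phi>
    using T \<phi> ring_axioms by (intro ring_hom_ringI2)
  note ij = cover_facts[OF cov]
  have zT: "z \<in> carrier T" and zc: "\<And>x. x \<in> carrier T \<Longrightarrow> z \<otimes>\<^bsub>T\<^esub> x = x \<otimes>\<^bsub>T\<^esub> z"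
    using z by (auto simp: ring_center_def)
  show ?thesis
  proof (rule inc.subringI)
    show "\<one>\<^bsub>\<A>\<^esub> \<in> ?H"
      using ij(1-3) zT by (simp add: inc_one_entry T.minus_eq T.r_neg)
    fix A assume "A \<in> ?H"
    then have A: "A \<in> carrier \<A>" "\<phi> (A (i, j)) = (\<phi> (A (i, i)) \<ominus>\<^bsub>T\<^esub> \<phi> (A (j, j))) \<otimes>\<^bsub>T\<^esub> z"
      by auto
    define a1 a2 where "a1 = \<phi> (A (i, i))" and "a2 = \<phi> (A (j, j))"
    have a: "a1 \<in> carrier T" "a2 \<in> carrier T"
      using A(1) ij by (auto simp: a1_def a2_def)
    show "\<ominus>\<^bsub>\<A>\<^esub> A \<in> ?H"
      using A ij(1,2) zT a unfolding a1_def a2_def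
      by (simp add: inc_minus_entry T.minus_eq T.l_minus[symmetric] T.minus_add T.a_comm)
    fix B assume "B \<in> ?H"
    then have B: "B \<in> carrier \<A>" "\<phi> (B (i, j)) = (\<phi> (B (i, i)) \<ominus>\<^bsub>T\<^esub> \<phi> (B (j, j))) \<otimes>\<^bsub>T\<^esub> z"
      by auto
    define b1 b2 where "b1 = \<phi> (B (i, i))" and "b2 = \<phi> (B (j, j))"
    have b: "b1 \<in> carrier T" "b2 \<in> carrier T"
      using B(1) ij by (auto simp: b1_def b2_def)
    have "\<phi> ((A \<oplus>\<^bsub>\<A>\<^esub> B) (i, j)) = (a1 \<ominus>\<^bsub>T\<^esub> a2) \<otimes>\<^bsub>T\<^esub> z \<oplus>\<^bsub>T\<^esub> (b1 \<ominus>\<^bsub>T\<^esub> b2) \<otimes>\<^bsub>T\<^esub> z"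
      using A B ij(1,2) by (simp add: inc_add_entry a1_def a2_def b1_def b2_def)
    also have "\<dots> = ((a1 \<oplus>\<^bsub>T\<^esub> b1) \<ominus>\<^bsub>T\<^esub> (a2 \<oplus>\<^bsub>T\<^esub> b2)) \<otimes>\<^bsub>T\<^esub> z"
      using a b zT by (simp add: T.l_distr T.minus_eq T.minus_add T.l_minus T.a_ac)
    finally show "A \<oplus>\<^bsub>\<A>\<^esub> B \<in> ?H"
      using A B ij(1,2) by (simp add: inc_add_entry a1_def a2_def b1_def b2_def)
    have "\<phi> ((A \<otimes>\<^bsub>\<A>\<^esub> B) (i, j)) = \<phi> (A (i, i) \<otimes> B (i, j) \<oplus> A (i, j) \<otimes> B (j, j))"
      using inc_offdiag_mult[OF A(1) B(1) ij(1-3,5)] by simp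
    also have "\<dots> = a1 \<otimes>\<^bsub>T\<^esub> ((b1 \<ominus>\<^bsub>T\<^esub> b2) \<otimes>\<^bsub>T\<^esub> z) \<oplus>\<^bsub>T\<^esub> ((a1 \<ominus>\<^bsub>T\<^esub> a2) \<otimes>\<^bsub>T\<^esub> z) \<otimes>\<^bsub>T\<^esub> b2"
      using A B ij(1,2) by (simp add: a1_def a2_def b1_def b2_def)
    also have "((a1 \<ominus>\<^bsub>T\<^esub> a2) \<otimes>\<^bsub>T\<^esub> z) \<otimes>\<^bsub>T\<^esub> b2 = ((a1 \<ominus>\<^bsub>T\<^esub> a2) \<otimes>\<^bsub>T\<^esub> b2) \<otimes>\<^bsub>T\<^esub> z"
      using a b zT zc[of b2] by (simp add: T.m_assoc)
    also have "a1 \<otimes>\<^bsub>T\<^esub> ((b1 \<ominus>\<^bsub>T\<^esub> b2) \<otimes>\<^bsub>T\<^esub> z) \<oplus>\<^bsub>T\<^esub> ((a1 \<ominus>\<^bsub>T\<^esub> a2) \<otimes>\<^bsub>T\<^esub> b2) \<otimes>\<^bsub>T\<^esub> z =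
        (a1 \<otimes>\<^bsub>T\<^esub> (b1 \<ominus>\<^bsub>T\<^esub> b2) \<oplus>\<^bsub>T\<^esub> (a1 \<ominus>\<^bsub>T\<^esub> a2) \<otimes>\<^bsub>T\<^esub> b2) \<otimes>\<^bsub>T\<^esub> z"
      using a b zT by (simp add: T.m_assoc T.l_distr)
    also have "a1 \<otimes>\<^bsub>T\<^esub> (b1 \<ominus>\<^bsub>T\<^esub> b2) \<oplus>\<^bsub>T\<^esub> (a1 \<ominus>\<^bsub>T\<^esub> a2) \<otimes>\<^bsub>T\<^esub> b2 = a1 \<otimes>\<^bsub>T\<^esub> b1 \<ominus>\<^bsub>T\<^esub> a2 \<otimes>\<^bsub>T\<^esub> b2"
      using a b by algebra
    finally show "A \<otimes>\<^bsub>\<A>\<^esub> B \<in> ?H"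
      using A B ij(1,2) by (simp add: inc_diag_mult a1_def a2_def b1_def b2_def)
  qed auto
qed

lemma single_entry_mat:
  assumes "(i, j) \<in> po"
  shows "\<exists>A\<in>carrier \<A>. \<forall>u\<in>{1..n}. \<forall>v\<in>{1..n}. A (u, v) = (if (u, v) = (i, j) then \<one> else \<zero>)"
proof (intro bexI ballI)
  let ?A = "\<lambda>p\<in>{1..n} \<times> {1..n}. if p = (i, j) then \<one> else \<zero>"
  show "?A \<in> carrier \<A>"
    using assms by (auto simp: inc_carrier mat_carrier)
qed simp

text \<open>
  If a condition failed, one of the two subrings above would contain the generators and the scalars, hence
  everything; but it misses a matrix unit, because \<open>1 \<noteq> 0\<close> in \<open>T\<close>.
\<close>

lemma generators_separate:
  assumes T: "ring T" and ne: "\<one>\<^bsub>T\<^esub> \<noteq> \<zero>\<^bsub>T\<^esub>" and \<phi>: "\<phi> \<in> ring_hom R T"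
    and G: "G \<subseteq> carrier \<A>" and gen: "generate_ring \<A> (G \<union> scalar_matrices n R) = carrier \<A>"
  shows "separates G T \<phi>"
proof -
  interpret inc: ring \<A>
    by (rule inc_ring)
  interpret T: ring T
    by (rule T)
  interpret \<phi>: ring_hom_ring R T \<phi>
    using T \<phi> ring_axioms by (intro ring_hom_ringI2)
  have GS: "G \<union> scalar_matrices n R \<subseteq> carrier \<A>"
    using G scalar_mat_closed by (auto simp: scalar_matrices_eq)
  have all: "H = carrier \<A>" if "subring H \<A>" "G \<subseteq> H" "scalar_matrices n R \<subseteq> H" for H
    using inc.generate_ring_min_subring1[OF GS that(1)] that gen subringE(1)[OF that(1)] by auto
  have diag: "\<exists>A\<in>G. \<phi> (A (i, i)) \<noteq> \<phi> (A (j, j))"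
    if ij: "i \<in> {1..n}" "j \<in> {1..n}" "i \<noteq> j" for i j
  proof (rule ccontr)
    assume none: "\<not> ?thesis"
    have eq: "{A \<in> carrier \<A>. \<phi> (A (i, i)) = \<phi> (A (j, j))} = carrier \<A>"
    proof (rule all)
      show "subring {A \<in> carrier \<A>. \<phi> (A (i, i)) = \<phi> (A (j, j))} \<A>"
        using equal_diagonal_subring[OF T \<phi> ij(1,2)] .
    qed (use none G ij in \<open>auto simp: scalar_matrices_eq scalar_mat_closed scalar_mat_entry\<close>)
    obtain A where A: "A \<in> carrier \<A>" "\<forall>u\<in>{1..n}. \<forall>v\<in>{1..n}. A (u, v) = (if (u, v) = (i, i) then \<one> else \<zero>)"
      using single_entry_mat[OF po_refl[OF ij(1)]] by blast
    have "\<phi> (A (i, i)) = \<phi> (A (j, j))"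
      using A(1) eq by blast
    then show False
      using A(2) ij ne by simp
  qed
  have "\<exists>A\<in>G. \<phi> (A (i, j)) \<noteq> (\<phi> (A (i, i)) \<ominus>\<^bsub>T\<^esub> \<phi> (A (j, j))) \<otimes>\<^bsub>T\<^esub> z"
    if cov: "covered_by po i j" and z: "z \<in> ring_center T" for i j z
  proof (rule ccontr)
    assume none: "\<not> ?thesis"
    note ij = cover_facts[OF cov]
    have zT: "z \<in> carrier T"
      using z by (simp add: ring_center_def)
    have eq: "{A \<in> carrier \<A>. \<phi> (A (i, j)) = (\<phi> (A (i, i)) \<ominus>\<^bsub>T\<^esub> \<phi> (A (j, j))) \<otimes>\<^bsub>T\<^esub> z} = carrier \<A>"
      (is "?H = _")
    proof (rule all)
      show "subring ?H \<A>"
        using proportional_cover_subring[OF T \<phi> cov z] .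
      show "scalar_matrices n R \<subseteq> ?H"
        using ij(1-3) zT
        by (auto simp: scalar_matrices_eq scalar_mat_closed scalar_mat_entry T.minus_eq T.r_neg)
    qed (use none G in auto)
    obtain A where A: "A \<in> carrier \<A>" "\<forall>u\<in>{1..n}. \<forall>v\<in>{1..n}. A (u, v) = (if (u, v) = (i, j) then \<one> else \<zero>)"
      using single_entry_mat[OF ij(4)] by blast
    have "\<phi> (A (i, j)) = (\<phi> (A (i, i)) \<ominus>\<^bsub>T\<^esub> \<phi> (A (j, j))) \<otimes>\<^bsub>T\<^esub> z"
      using A(1) eq by blast
    then show False
      using A(2) ij(1-3) ne zT by (simp add: T.minus_eq)
  qed
  then show ?thesis
    using diag by (simp add: separates_def)
qed

text \<open>
  Suppose that the ideal of \<open>(i, i)\<close> entries of members of \<open>S\<close> vanishing at \<open>(j, j)\<close> is killed by \<open>\<phi>\<^sub>k\<close>.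
  Subtracting a scalar makes any member vanish at \<open>(j, j)\<close>, so \<open>\<phi>\<^sub>k\<close> agrees on the two diagonal entries
  of every member.

  Suppose next that the ideal of \<open>(i, j)\<close> entries of members vanishing at \<open>(i, i)\<close> and \<open>(j, j)\<close> is killed,
  for a cover. Take \<open>P \<in> S\<close> with diagonal entries \<open>1\<close> and \<open>0\<close> at \<open>i\<close> and \<open>j\<close>, and let \<open>p\<close> be its \<open>(i, j)\<close>
  entry. Commutators of \<open>P\<close> with scalars have zero diagonal there, so \<open>\<phi>\<^sub>k p\<close> is central; and reducing
  an arbitrary member by multiples of \<open>P\<close> and \<open>1\<close> shows that its \<open>(i, j)\<close> entry is the difference of the
  diagonal entries times \<open>p\<close>, modulo the kernel of \<open>\<phi>\<^sub>k\<close>. Both outcomes contradict the hypothesis.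
\<close>

lemma separating_generates:
  fixes K :: "'k set" and T :: "'k \<Rightarrow> ('c, 'd) ring_scheme"
  assumes T: "\<And>k. k \<in> K \<Longrightarrow> ring (T k)" and \<phi>: "\<And>k. k \<in> K \<Longrightarrow> \<phi> k \<in> ring_hom R (T k)"
    and surj: "\<And>k. k \<in> K \<Longrightarrow> \<phi> k ` carrier R = carrier (T k)"
    and proper: "\<And>I. ideal I R \<Longrightarrow> I \<noteq> carrier R \<Longrightarrow> \<exists>k\<in>K. \<forall>x\<in>I. \<phi> k x = \<zero>\<^bsub>T k\<^esub>"
    and G: "G \<subseteq> carrier \<A>" and separates: "\<And>k. k \<in> K \<Longrightarrow> separates G (T k) (\<phi> k)"
  shows "generate_ring \<A> (G \<union> scalar_matrices n R) = carrier \<A>"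
proof -
  define S where "S = generate_ring \<A> (G \<union> scalar_matrices n R)"
  interpret inc: ring \<A>
    by (rule inc_ring)
  have GS: "G \<union> scalar_matrices n R \<subseteq> carrier \<A>"
    using G scalar_mat_closed by (auto simp: scalar_matrices_eq)
  interpret scalar_subring R n po S
  proof (intro scalar_subring.intro incidence_axioms scalar_subring_axioms.intro)
    show "subring S \<A>"
      using inc.generate_ring_is_subring[OF GS] by (simp add: S_def)
  qed (auto simp: S_def intro: generate_ring.incl)
  have GinS: "A \<in> S" if "A \<in> G" for A
    using that by (auto simp: S_def intro: generate_ring.incl)
  have sep: "\<exists>A\<in>S. A (i, i) = \<one> \<and> A (j, j) = \<zero>"
    if ij: "i \<in> {1..n}" "j \<in> {1..n}" "i \<noteq> j" for i j
  proof -
    define I where "I = (\<lambda>A. A (i, i)) ` {A \<in> S. \<forall>q\<in>{(j, j)}. A q = \<zero>}"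
    have I: "ideal I R"
      unfolding I_def using ij by (intro entry_ideal) auto
    have "I = carrier R"
    proof (rule ccontr)
      assume "I \<noteq> carrier R"
      then obtain k where k: "k \<in> K" "\<forall>x\<in>I. \<phi> k x = \<zero>\<^bsub>T k\<^esub>"
        using proper[OF I] by blast
      interpret \<phi>: ring_hom_ring R "T k" "\<phi> k"
        using T \<phi> k ring_axioms by (intro ring_hom_ringI2) auto
      have "\<phi> k (A (i, i)) = \<phi> k (A (j, j))" if A: "A \<in> S" for A
      proof -
        define r where "r = A (j, j)"
        have r: "r \<in> carrier R"
          using A ij by (simp add: r_def)
        define B where "B = A \<ominus>\<^bsub>\<A>\<^esub> scalar_mat r"
        have B: "B \<in> S"
          using S_diff[OF A S_scalar[OF r]] by (simp add: B_def)
        have "B (u, u) = A (u, u) \<ominus> r" if "u \<in> {1..n}" for u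
          using diff_entry[OF S_carrier[OF A] scalar_mat_closed[OF r] that that] r that
          by (simp add: B_def scalar_mat_entry)
        then have "B (i, i) = A (i, i) \<ominus> r" "B (j, j) = \<zero>"
          using ij r by (simp_all add: r_def minus_eq r_neg)
        then have "A (i, i) \<ominus> r \<in> I"
          using B unfolding I_def by (intro image_eqI[of _ _ B]) auto
        then have "\<phi> k (A (i, i)) \<ominus>\<^bsub>T k\<^esub> \<phi> k r = \<zero>\<^bsub>T k\<^esub>"
          using k A ij r by (metis S_entry \<phi>.hom_diff)
        then show ?thesis
          using A ij r by (simp add: r_def)
      qed
      then show False
        using separates[OF k(1)] ij GinS unfolding separates_def by blast
    qed
    then have "\<one> \<in> I"
      by simp
    then show ?thesis
      unfolding I_def by force
  qed
  have cover: "\<exists>A\<in>S. A (i, j) = \<one> \<and> A (i, i) = \<zero> \<and> A (j, j) = \<zero>"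
    if cov: "covered_by po i j" for i j
  proof -
    note ij = cover_facts[OF cov]
    define I where "I = (\<lambda>A. A (i, j)) ` {A \<in> S. \<forall>q\<in>{(i, i), (j, j)}. A q = \<zero>}"
    have I: "ideal I R"
      unfolding I_def using ij by (intro entry_ideal) auto
    obtain P where P: "P \<in> S" "P (i, i) = \<one>" "P (j, j) = \<zero>"
      using sep[OF ij(1-3)] by blast
    define p where "p = P (i, j)"
    have pR: "p \<in> carrier R"
      using P(1) ij by (simp add: p_def)
    have "I = carrier R"
    proof (rule ccontr)
      assume "I \<noteq> carrier R"
      then obtain k where k: "k \<in> K" "\<forall>x\<in>I. \<phi> k x = \<zero>\<^bsub>T k\<^esub>"
        using proper[OF I] by blast
      interpret \<phi>: ring_hom_ring R "T k" "\<phi> k"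
        using T \<phi> k ring_axioms by (intro ring_hom_ringI2) auto
      have kill: "\<phi> k (A (i, j)) = \<zero>\<^bsub>T k\<^esub>" if "A \<in> S" "A (i, i) = \<zero>" "A (j, j) = \<zero>" for A
        using k(2) that unfolding I_def by (intro bspec[OF k(2)[unfolded I_def]] image_eqI[of _ _ A]) auto
      have "\<phi> k r \<otimes>\<^bsub>T k\<^esub> \<phi> k p = \<phi> k p \<otimes>\<^bsub>T k\<^esub> \<phi> k r" if r: "r \<in> carrier R" for r
      proof -
        define B where "B = scalar_mat r \<otimes>\<^bsub>\<A>\<^esub> P \<ominus>\<^bsub>\<A>\<^esub> P \<otimes>\<^bsub>\<A>\<^esub> scalar_mat r"
        have S2: "scalar_mat r \<otimes>\<^bsub>\<A>\<^esub> P \<in> S" "P \<otimes>\<^bsub>\<A>\<^esub> scalar_mat r \<in> S"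
          using S_mult S_scalar[OF r] P(1) by blast+
        then have B: "B \<in> S"
          unfolding B_def by (rule S_diff)
        have e: "B (u, v) = r \<otimes> P (u, v) \<ominus> P (u, v) \<otimes> r" if "u \<in> {1..n}" "v \<in> {1..n}" for u v
          using diff_entry[OF S_carrier[OF S2(1)] S_carrier[OF S2(2)] that]
            scalar_mult_entry[OF r S_carrier[OF P(1)] that] by (simp add: B_def)
        have "B (i, i) = \<zero>" "B (j, j) = \<zero>"
          using e ij P r by (simp_all add: minus_eq r_neg)
        then have "\<phi> k (B (i, j)) = \<zero>\<^bsub>T k\<^esub>"
          using kill[OF B] by simp
        then have "\<phi> k r \<otimes>\<^bsub>T k\<^esub> \<phi> k p \<ominus>\<^bsub>T k\<^esub> \<phi> k p \<otimes>\<^bsub>T k\<^esub> \<phi> k r = \<zero>\<^bsub>T k\<^esub>"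
          using e[OF ij(1,2)] pR r by (simp add: p_def[symmetric])
        then show ?thesis
          using pR r by simp
      qed
      then have center: "\<phi> k p \<in> ring_center (T k)"
        using pR surj[OF k(1), symmetric] by (auto simp: ring_center_def)
      have "\<phi> k (A (i, j)) = (\<phi> k (A (i, i)) \<ominus>\<^bsub>T k\<^esub> \<phi> k (A (j, j))) \<otimes>\<^bsub>T k\<^esub> \<phi> k p"
        if A: "A \<in> S" for A
      proof -
        define r s where "r = A (i, i) \<ominus> A (j, j)" and "s = A (j, j)"
        have r: "r \<in> carrier R" and s: "s \<in> carrier R" and Aii: "A (i, i) \<in> carrier R"
          using A ij by (simp_all add: r_def s_def)
        have S1: "scalar_mat r \<otimes>\<^bsub>\<A>\<^esub> P \<in> S"
          using S_mult S_scalar[OF r] P(1) by blast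
        have S2: "A \<ominus>\<^bsub>\<A>\<^esub> scalar_mat r \<otimes>\<^bsub>\<A>\<^esub> P \<in> S"
          using A S1 by (rule S_diff)
        define B where "B = (A \<ominus>\<^bsub>\<A>\<^esub> scalar_mat r \<otimes>\<^bsub>\<A>\<^esub> P) \<ominus>\<^bsub>\<A>\<^esub> scalar_mat s"
        have B: "B \<in> S"
          unfolding B_def using S2 S_scalar[OF s] by (rule S_diff)
        have e: "B (u, v) = (A (u, v) \<ominus> r \<otimes> P (u, v)) \<ominus> (if u = v then s else \<zero>)"
          if "u \<in> {1..n}" "v \<in> {1..n}" for u v
          using diff_entry[OF S_carrier[OF S2] scalar_mat_closed[OF s] that]
            diff_entry[OF S_carrier[OF A] S_carrier[OF S1] that]
            scalar_mult_entry(1)[OF r S_carrier[OF P(1)] that] scalar_mat_entry[OF s that]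
          by (simp add: B_def)
        have "A (i, i) \<ominus> (A (i, i) \<ominus> s) \<ominus> s = \<zero>"
          using Aii s by algebra
        then have "B (i, i) = \<zero>"
          using e[of i i] ij P(2) r by (simp add: r_def s_def)
        moreover have "B (j, j) = \<zero>"
          using e[of j j] ij P(3) r s by (simp add: s_def[symmetric] minus_eq r_neg)
        ultimately have "\<phi> k (B (i, j)) = \<zero>\<^bsub>T k\<^esub>"
          using kill[OF B] by simp
        moreover have "B (i, j) = A (i, j) \<ominus> r \<otimes> p"
          using e[of i j] ij(1-3) A r pR by (simp add: p_def[symmetric] minus_eq)
        ultimately have "\<phi> k (A (i, j)) \<ominus>\<^bsub>T k\<^esub> \<phi> k r \<otimes>\<^bsub>T k\<^esub> \<phi> k p = \<zero>\<^bsub>T k\<^esub>"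
          using A ij(1,2) r pR by simp
        then have "\<phi> k (A (i, j)) = \<phi> k r \<otimes>\<^bsub>T k\<^esub> \<phi> k p"
          using A ij(1,2) r pR by simp
        then show ?thesis
          using A ij(1,2) by (simp add: r_def)
      qed
      then show False
        using separates[OF k(1)] cov center GinS unfolding separates_def by blast
    qed
    then have "\<one> \<in> I"
      by simp
    then show ?thesis
      unfolding I_def by force
  qed
  show ?thesis
    using subring_is_everything[OF sep cover] by (simp add: S_def)
qed

end

section \<open>The Jacobson radical and the simple quotients\<close>

lemma left_idealD:
  assumes "left_ideal I R"
  shows "additive_subgroup I R" "\<And>a x. a \<in> I \<Longrightarrow> x \<in> carrier R \<Longrightarrow> x \<otimes>\<^bsub>R\<^esub> a \<in> I"
  using assms by (auto simp: left_ideal_def)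

context ring
begin

lemma left_idealI:
  assumes "I \<subseteq> carrier R" "\<zero> \<in> I" "\<And>a b. a \<in> I \<Longrightarrow> b \<in> I \<Longrightarrow> a \<oplus> b \<in> I"
    "\<And>a x. a \<in> I \<Longrightarrow> x \<in> carrier R \<Longrightarrow> x \<otimes> a \<in> I"
  shows "left_ideal I R"
proof -
  have "\<ominus> a \<in> I" if "a \<in> I" for a
    using assms(4)[OF that, of "\<ominus> \<one>"] that assms(1) by (auto simp: l_minus)
  then have "subgroup I (add_monoid R)"
    using assms by (intro add.subgroupI) auto
  then show ?thesis
    using assms by (simp add: left_ideal_def additive_subgroup_def)
qed

lemma left_ideal_closed:
  assumes "left_ideal I R"
  shows "I \<subseteq> carrier R" "\<zero> \<in> I" "\<And>a b. a \<in> I \<Longrightarrow> b \<in> I \<Longrightarrow> a \<oplus> b \<in> I"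
    "\<And>a. a \<in> I \<Longrightarrow> \<ominus> a \<in> I"
proof -
  interpret additive_subgroup I R
    using left_idealD(1)[OF assms] .
  show "I \<subseteq> carrier R" "\<zero> \<in> I" "\<And>a b. a \<in> I \<Longrightarrow> b \<in> I \<Longrightarrow> a \<oplus> b \<in> I"
    "\<And>a. a \<in> I \<Longrightarrow> \<ominus> a \<in> I"
    by (auto simp: a_subset zero_closed a_inv_closed)
qed

lemma left_ideal_one_imp_carrier:
  assumes "left_ideal I R" "\<one> \<in> I"
  shows "I = carrier R"
  using left_idealD(2)[OF assms] left_ideal_closed(1)[OF assms(1)] by fastforce

text \<open>
  Right multiplication by \<open>r\<close> embeds \<open>R\<close> modulo the colon ideal into the simple left module \<open>R/M\<close>, and the
  embedding is onto because \<open>r \<notin> M\<close>. Concretely, if \<open>l r \<notin> M\<close> then \<open>R l r + M = R\<close> contains \<open>r\<close>, which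
  puts \<open>1\<close> into every left ideal that contains the colon ideal and \<open>l\<close>.
\<close>

lemma colon_maximal_left_ideal:
  assumes M: "maximal_left_ideal M R" and r: "r \<in> carrier R" and rM: "r \<notin> M"
  shows "maximal_left_ideal {x \<in> carrier R. x \<otimes> r \<in> M} R" (is "maximal_left_ideal ?C R")
proof -
  have lM: "left_ideal M R" and maxM: "\<And>J. left_ideal J R \<Longrightarrow> M \<subseteq> J \<Longrightarrow> J = M \<or> J = carrier R"
    using M by (auto simp: maximal_left_ideal_def)
  note cM = left_ideal_closed[OF lM] left_idealD(2)[OF lM]
  have C: "left_ideal ?C R"
    using r cM by (intro left_idealI) (auto simp: l_distr m_assoc)
  moreover have "?C \<noteq> carrier R"
  proof
    assume "?C = carrier R"
    then have "\<one> \<in> ?C"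
      by simp
    then show False
      using r rM by simp
  qed
  moreover have "J = ?C \<or> J = carrier R" if J: "left_ideal J R" "?C \<subseteq> J" for J
  proof (rule disjCI)
    assume "J \<noteq> carrier R"
    note cJ = left_ideal_closed[OF J(1)] left_idealD(2)[OF J(1)]
    have "l \<in> ?C" if l: "l \<in> J" for l
    proof (rule ccontr)
      assume "l \<notin> ?C"
      then have lc: "l \<in> carrier R" and lr: "l \<otimes> r \<notin> M"
        using l cJ(1) by auto
      define L where "L = {s \<otimes> (l \<otimes> r) \<oplus> y | s y. s \<in> carrier R \<and> y \<in> M}"
      have "left_ideal L R"
      proof (rule left_idealI)
        show "L \<subseteq> carrier R"
          using cM lc r by (auto simp: L_def)
        show "\<zero> \<in> L"
          unfolding L_def using cM lc r by (intro CollectI exI[of _ \<zero>]) auto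
        fix a assume "a \<in> L"
        then obtain s y where a: "a = s \<otimes> (l \<otimes> r) \<oplus> y" "s \<in> carrier R" "y \<in> M"
          by (auto simp: L_def)
        then have y: "y \<in> carrier R"
          using cM by auto
        {
          fix b assume "b \<in> L"
          then obtain t z where b: "b = t \<otimes> (l \<otimes> r) \<oplus> z" "t \<in> carrier R" "z \<in> M"
            by (auto simp: L_def)
          then have z: "z \<in> carrier R"
            using cM by auto
          have "a \<oplus> b = (s \<oplus> t) \<otimes> (l \<otimes> r) \<oplus> (y \<oplus> z)"
            using a b y z lc r by (simp add: l_distr a_ac)
          then show "a \<oplus> b \<in> L"
            unfolding L_def using a b cM(3) by blast
        }
        fix x assume x: "x \<in> carrier R"
        have "x \<otimes> a = (x \<otimes> s) \<otimes> (l \<otimes> r) \<oplus> x \<otimes> y"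
          using a x y lc r by (simp add: r_distr m_assoc)
        then show "x \<otimes> a \<in> L"
          unfolding L_def using a x cM(5) by blast
      qed
      moreover have "M \<subseteq> L"
      proof
        fix y assume y: "y \<in> M"
        then have "y = \<zero> \<otimes> (l \<otimes> r) \<oplus> y"
          using cM lc r by auto
        then show "y \<in> L"
          unfolding L_def using y by blast
      qed
      moreover have "l \<otimes> r \<in> L"
      proof -
        have "l \<otimes> r = \<one> \<otimes> (l \<otimes> r) \<oplus> \<zero>"
          using lc r by simp
        then show ?thesis
          unfolding L_def using cM by blast
      qed
      ultimately have "L = carrier R"
        using maxM lr by blast
      then have "r \<in> L"
        using r by simp
      then obtain s y where s: "r = s \<otimes> (l \<otimes> r) \<oplus> y" "s \<in> carrier R" "y \<in> M"
        unfolding L_def by blast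
      then have y: "y \<in> carrier R"
        using cM by auto
      have "(\<one> \<ominus> s \<otimes> l) \<otimes> r = r \<ominus> s \<otimes> (l \<otimes> r)"
        using s lc r by (simp add: minus_eq l_distr l_minus m_assoc)
      also have "\<dots> = (s \<otimes> (l \<otimes> r) \<oplus> y) \<ominus> s \<otimes> (l \<otimes> r)"
        using s(1) by simp
      also have "\<dots> = y"
        using s(2) y lc r by algebra
      finally have "\<one> \<ominus> s \<otimes> l \<in> ?C"
        using s lc by simp
      then have "\<one> \<ominus> s \<otimes> l \<in> J"
        using J(2) by blast
      then have "(\<one> \<ominus> s \<otimes> l) \<oplus> s \<otimes> l \<in> J"
        using cJ(3) cJ(5)[OF l s(2)] by blast
      moreover have "(\<one> \<ominus> s \<otimes> l) \<oplus> s \<otimes> l = \<one>"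
        using s(2) lc by algebra
      ultimately show False
        using left_ideal_one_imp_carrier[OF J(1)] \<open>J \<noteq> carrier R\<close> by simp
    qed
    then show "J = ?C"
      using J(2) by blast
  qed
  ultimately show ?thesis
    by (simp add: maximal_left_ideal_def)
qed

text \<open>
  Closure under right multiplication is the only issue: \<open>a x \<in> M\<close> means that \<open>a\<close> lies in the colon ideal of
  \<open>M\<close> and \<open>x\<close>, which is again maximal unless \<open>x \<in> M\<close>.
\<close>

lemma jacobson_radical_ideal: "ideal (jacobson_radical R) R"
proof -
  let ?J = "jacobson_radical R"
  have ml: "left_ideal M R" if "maximal_left_ideal M R" for M
    using that by (simp add: maximal_left_ideal_def)
  have J: "left_ideal ?J R"
    by (rule left_idealI)
      (auto simp: jacobson_radical_def dest: ml intro: left_ideal_closed[OF ml] left_idealD(2)[OF ml])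
  show ?thesis
  proof (rule idealI)
    show "subgroup ?J (add_monoid R)"
      using left_idealD(1)[OF J] by (simp add: additive_subgroup_def)
    fix a x assume a: "a \<in> ?J" and x: "x \<in> carrier R"
    show "x \<otimes> a \<in> ?J"
      using left_idealD(2)[OF J a x] .
    have ac: "a \<in> carrier R"
      using a by (simp add: jacobson_radical_def)
    have "a \<otimes> x \<in> M" if M: "maximal_left_ideal M R" for M
    proof (cases "x \<in> M")
      case True
      then show ?thesis
        using left_idealD(2)[OF ml[OF M]] ac by blast
    next
      case False
      then have "a \<in> {y \<in> carrier R. y \<otimes> x \<in> M}"
        using a colon_maximal_left_ideal[OF M x] unfolding jacobson_radical_def by blast
      then show ?thesis
        by simp
    qed
    then show "a \<otimes> x \<in> ?J"
      using ac x by (simp add: jacobson_radical_def)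
  qed (rule ring_axioms)
qed

lemma exists_maximal_left_ideal:
  assumes fin: "finite (carrier R)" and I: "left_ideal I R" "I \<noteq> carrier R"
  shows "\<exists>M. maximal_left_ideal M R \<and> I \<subseteq> M"
proof -
  define F where "F = {J. left_ideal J R \<and> J \<noteq> carrier R \<and> I \<subseteq> J}"
  have "F \<subseteq> Pow (carrier R)"
    using left_ideal_closed(1) by (auto simp: F_def)
  then have "finite F"
    using fin by (simp add: finite_subset)
  moreover have "I \<in> F"
    using I by (simp add: F_def)
  ultimately obtain M where M: "M \<in> F" "\<And>J. J \<in> F \<Longrightarrow> M \<subseteq> J \<Longrightarrow> M = J"
    using finite_has_maximal[of F] by auto
  then have "maximal_left_ideal M R"
    unfolding maximal_left_ideal_def F_def by blast
  then show ?thesis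
    using M(1) by (auto simp: F_def)
qed

text \<open>
  Nakayama: a maximal left ideal above a proper \<open>I\<close> would contain both \<open>x\<close> and \<open>1 - x\<close>.
\<close>

lemma ideal_comaximal_radical:
  assumes fin: "finite (carrier R)" and I: "ideal I R"
    and x: "x \<in> I" "\<one> \<ominus> x \<in> jacobson_radical R"
  shows "I = carrier R"
proof (rule ccontr)
  assume ne: "I \<noteq> carrier R"
  interpret I: ideal I R
    by (rule I)
  have "left_ideal I R"
    by (rule left_idealI) (auto simp: I.a_subset I.I_l_closed)
  then obtain M where M: "maximal_left_ideal M R" "I \<subseteq> M"
    using exists_maximal_left_ideal[OF fin _ ne] by blast
  have lM: "left_ideal M R"
    using M(1) by (simp add: maximal_left_ideal_def)
  have xc: "x \<in> carrier R"
    using x I.a_subset by auto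
  have "\<one> \<ominus> x \<in> M"
    using x(2) M(1) by (auto simp: jacobson_radical_def)
  then have "(\<one> \<ominus> x) \<oplus> x \<in> M"
    using left_ideal_closed(3)[OF lM] x(1) M(2) by blast
  moreover have "(\<one> \<ominus> x) \<oplus> x = \<one>"
    using xc by algebra
  ultimately have "M = carrier R"
    using left_ideal_one_imp_carrier[OF lM] by simp
  then show False
    using M(1) by (simp add: maximal_left_ideal_def)
qed

end

lemma RDirProd_list_nth_hom:
  assumes "i < length Rs"
  shows "(\<lambda>xs. xs ! i) \<in> ring_hom (RDirProd_list Rs) (Rs ! i)"
  using assms
proof (induction Rs arbitrary: i)
  case (Cons S Rs)
  let ?P = "RDirProd S (RDirProd_list Rs)"
  have h: "(\<lambda>(a, as). a # as) \<in> ring_hom ?P (RDirProd_list (S # Rs))"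
    by (rule RDirProd_list_hom1)
  have car: "carrier (RDirProd_list (S # Rs)) = (\<lambda>(a, as). a # as) ` carrier ?P"
    by (simp add: RDirProd_list_carrier RDirProd_carrier)
  have "(\<lambda>p. (fst p # snd p) ! i) \<in> ring_hom ?P ((S # Rs) ! i)"
  proof (cases i)
    case 0
    then show ?thesis
      by (auto simp: ring_hom_def RDirProd_def DirProd_def monoid.defs)
  next
    case (Suc l)
    then have "(\<lambda>xs. xs ! l) \<in> ring_hom (RDirProd_list Rs) (Rs ! l)"
      using Cons by simp
    then show ?thesis
      using Suc by (auto simp: ring_hom_def RDirProd_def DirProd_def monoid.defs)
  qed
  note g = this
  show ?case
  proof (rule ring_hom_memI)
    fix x assume "x \<in> carrier (RDirProd_list (S # Rs))"
    then obtain p where p: "p \<in> carrier ?P" "x = fst p # snd p"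
      by (auto simp: car)
    show "x ! i \<in> carrier ((S # Rs) ! i)"
      using ring_hom_closed[OF g p(1)] p by simp
    fix y assume "y \<in> carrier (RDirProd_list (S # Rs))"
    then obtain q where q: "q \<in> carrier ?P" "y = fst q # snd q"
      by (auto simp: car)
    have "x \<otimes>\<^bsub>RDirProd_list (S # Rs)\<^esub> y = fst (p \<otimes>\<^bsub>?P\<^esub> q) # snd (p \<otimes>\<^bsub>?P\<^esub> q)"
      using ring_hom_mult[OF h p(1) q(1)] p q by (simp add: case_prod_beta)
    then show "(x \<otimes>\<^bsub>RDirProd_list (S # Rs)\<^esub> y) ! i = x ! i \<otimes>\<^bsub>(S # Rs) ! i\<^esub> y ! i"
      using ring_hom_mult[OF g p(1) q(1)] p q by simp
    have "x \<oplus>\<^bsub>RDirProd_list (S # Rs)\<^esub> y = fst (p \<oplus>\<^bsub>?P\<^esub> q) # snd (p \<oplus>\<^bsub>?P\<^esub> q)"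
      using ring_hom_add[OF h p(1) q(1)] p q by (simp add: case_prod_beta)
    then show "(x \<oplus>\<^bsub>RDirProd_list (S # Rs)\<^esub> y) ! i = x ! i \<oplus>\<^bsub>(S # Rs) ! i\<^esub> y ! i"
      using ring_hom_add[OF g p(1) q(1)] p q by simp
  next
    have "\<one>\<^bsub>RDirProd_list (S # Rs)\<^esub> = fst \<one>\<^bsub>?P\<^esub> # snd \<one>\<^bsub>?P\<^esub>"
      using ring_hom_one[OF h] by (simp add: case_prod_beta)
    then show "\<one>\<^bsub>RDirProd_list (S # Rs)\<^esub> ! i = \<one>\<^bsub>(S # Rs) ! i\<^esub>"
      using ring_hom_one[OF g] by simp
  qed
qed simp

definition simple_ring :: "('a, 'b) ring_scheme \<Rightarrow> bool" where
  "simple_ring T \<longleftrightarrow> ring T \<and> \<one>\<^bsub>T\<^esub> \<noteq> \<zero>\<^bsub>T\<^esub> \<and> (\<forall>I. ideal I T \<longrightarrow> I = {\<zero>\<^bsub>T\<^esub>} \<or> I = carrier T)"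

lemma (in ring_hom_ring) surj_image_ideal:
  assumes I: "ideal I R" and surj: "h ` carrier R = carrier S"
  shows "ideal (h ` I) S"
proof (rule idealI)
  interpret I: ideal I R
    by (rule I)
  show "subgroup (h ` I) (add_monoid S)"
  proof (rule S.add.subgroupI)
    show "h ` I \<subseteq> carrier S"
      using I.a_subset by auto
    show "h ` I \<noteq> {}"
      using I.zero_closed by blast
    fix a assume "a \<in> h ` I"
    then obtain x where x: "x \<in> I" "a = h x"
      by blast
    then have "\<ominus>\<^bsub>S\<^esub> a = h (\<ominus> x)"
      using I.a_subset by auto
    then show "\<ominus>\<^bsub>S\<^esub> a \<in> h ` I"
      using x I.a_inv_closed by blast
    fix b assume "b \<in> h ` I"
    then obtain y where y: "y \<in> I" "b = h y"
      by blast
    then have "a \<oplus>\<^bsub>S\<^esub> b = h (x \<oplus> y)"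
      using x I.a_subset by auto
    then show "a \<oplus>\<^bsub>S\<^esub> b \<in> h ` I"
      using x y I.a_closed by blast
  qed
  fix a s assume "a \<in> h ` I" and "s \<in> carrier S"
  then obtain x r where x: "x \<in> I" "a = h x" and r: "r \<in> carrier R" "s = h r"
    using surj by blast
  then have "s \<otimes>\<^bsub>S\<^esub> a = h (r \<otimes> x)" "a \<otimes>\<^bsub>S\<^esub> s = h (x \<otimes> r)"
    using I.a_subset by auto
  then show "s \<otimes>\<^bsub>S\<^esub> a \<in> h ` I" "a \<otimes>\<^bsub>S\<^esub> s \<in> h ` I"
    using I.I_l_closed[OF x(1) r(1)] I.I_r_closed[OF x(1) r(1)] by (metis imageI)+
qed (rule S.ring_axioms)

text \<open>
  What the proof uses of the Wedderburn--Artin decomposition: finitely many homomorphisms onto simple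
  rings whose common kernel lies in the radical. Joint surjectivity and equidistribution
  are both contained in the condition that all joint fibres have the same positive size \<open>N\<close>.
\<close>

locale wedderburn_quotients = ring R for R (structure) +
  fixes K :: "'k set" and T :: "'k \<Rightarrow> ('c, 'd) ring_scheme" and \<phi> :: "'k \<Rightarrow> 'a \<Rightarrow> 'c" and N :: nat
  assumes fin_R: "finite (carrier R)" and fin_K: "finite K"
    and simple: "\<And>k. k \<in> K \<Longrightarrow> simple_ring (T k)"
    and hom: "\<And>k. k \<in> K \<Longrightarrow> \<phi> k \<in> ring_hom R (T k)"
    and fibre_card: "\<And>y. y \<in> (\<Pi>\<^sub>E k\<in>K. carrier (T k)) \<Longrightarrow>
      card {r \<in> carrier R. \<forall>k\<in>K. \<phi> k r = y k} = N"
    and N_pos: "N > 0"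
    and kernel: "\<And>r. r \<in> carrier R \<Longrightarrow> (\<And>k. k \<in> K \<Longrightarrow> \<phi> k r = \<zero>\<^bsub>T k\<^esub>) \<Longrightarrow> r \<in> jacobson_radical R"
begin

lemma T_ring: "k \<in> K \<Longrightarrow> ring (T k)"
  using simple by (simp add: simple_ring_def)

lemma T_one_neq_zero: "k \<in> K \<Longrightarrow> \<one>\<^bsub>T k\<^esub> \<noteq> \<zero>\<^bsub>T k\<^esub>"
  using simple by (simp add: simple_ring_def)

lemma hom_ring: "k \<in> K \<Longrightarrow> ring_hom_ring R (T k) (\<phi> k)"
  using hom T_ring ring_axioms by (intro ring_hom_ringI2)

lemma joint_preimage:
  assumes "\<And>k. k \<in> K \<Longrightarrow> y k \<in> carrier (T k)"
  shows "\<exists>r\<in>carrier R. \<forall>k\<in>K. \<phi> k r = y k"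
proof -
  have "restrict y K \<in> (\<Pi>\<^sub>E k\<in>K. carrier (T k))"
    using assms by auto
  then have "card {r \<in> carrier R. \<forall>k\<in>K. \<phi> k r = restrict y K k} > 0"
    using N_pos by (simp only: fibre_card)
  then have "{r \<in> carrier R. \<forall>k\<in>K. \<phi> k r = restrict y K k} \<noteq> {}"
    by (metis card.empty less_irrefl)
  then show ?thesis
    by auto
qed

lemma surj:
  assumes k: "k \<in> K"
  shows "\<phi> k ` carrier R = carrier (T k)"
proof
  show "\<phi> k ` carrier R \<subseteq> carrier (T k)"
    using ring_hom_closed[OF hom[OF k]] by blast
  show "carrier (T k) \<subseteq> \<phi> k ` carrier R"
  proof
    fix t assume t: "t \<in> carrier (T k)"
    have "\<exists>r\<in>carrier R. \<forall>l\<in>K. \<phi> l r = (if l = k then t else \<zero>\<^bsub>T l\<^esub>)"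
      using t T_ring by (intro joint_preimage) (auto intro: ring.ring_simprules)
    then obtain r where "r \<in> carrier R" "\<phi> k r = t"
      using k by auto
    then show "t \<in> \<phi> k ` carrier R"
      by blast
  qed
qed

text \<open>
  If no \<open>\<phi>\<^sub>k\<close> kills \<open>I\<close>, simplicity gives elements of \<open>I\<close> that map to \<open>1\<close> in single factors. Lifts of the
  central idempotents of the product glue them to one \<open>x \<in> I\<close> that maps to \<open>1\<close> in all factors, so
  \<open>1 - x\<close> lies in the radical and \<open>I\<close> is not proper.
\<close>

lemma proper_ideal_killed:
  assumes I: "ideal I R" and ne: "I \<noteq> carrier R"
  shows "\<exists>k\<in>K. \<forall>x\<in>I. \<phi> k x = \<zero>\<^bsub>T k\<^esub>"
proof (rule ccontr)
  assume none: "\<not> ?thesis"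
  interpret I: ideal I R
    by (rule I)
  have one: "\<exists>x\<in>I. \<phi> k x = \<one>\<^bsub>T k\<^esub>" if k: "k \<in> K" for k
  proof -
    interpret k: ring_hom_ring R "T k" "\<phi> k"
      using hom_ring[OF k] .
    have "ideal (\<phi> k ` I) (T k)"
      using k.surj_image_ideal[OF I] surj[OF k] by simp
    moreover have "\<phi> k ` I \<noteq> {\<zero>\<^bsub>T k\<^esub>}"
      using none k by blast
    ultimately have "\<phi> k ` I = carrier (T k)"
      using simple[OF k] by (auto simp: simple_ring_def)
    then show ?thesis
      using k.S.one_closed by (metis imageE)
  qed
  have "\<exists>x\<in>I. \<forall>k\<in>L. \<phi> k x = \<one>\<^bsub>T k\<^esub>" if "finite L" "L \<subseteq> K" for L
    using that
  proof (induction L rule: finite_induct)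
    case empty
    then show ?case
      using I.zero_closed by blast
  next
    case (insert k L)
    then obtain x where x: "x \<in> I" "\<forall>l\<in>L. \<phi> l x = \<one>\<^bsub>T l\<^esub>"
      by auto
    have k: "k \<in> K"
      using insert by simp
    obtain y where y: "y \<in> I" "\<phi> k y = \<one>\<^bsub>T k\<^esub>"
      using one[OF k] by blast
    have "\<exists>e\<in>carrier R. \<forall>l\<in>K. \<phi> l e = (if l = k then \<one>\<^bsub>T l\<^esub> else \<zero>\<^bsub>T l\<^esub>)"
      using T_ring by (intro joint_preimage) (auto intro: ring.ring_simprules)
    then obtain e where e: "e \<in> carrier R"
      "\<And>l. l \<in> K \<Longrightarrow> \<phi> l e = (if l = k then \<one>\<^bsub>T l\<^esub> else \<zero>\<^bsub>T l\<^esub>)"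
      by blast
    have xy: "x \<in> carrier R" "y \<in> carrier R"
      using x y I.a_subset by auto
    \<comment> \<open>\<open>e\<close> lifts the idempotent of factor \<open>k\<close>, so this replaces \<open>x\<close> by \<open>y\<close> in that factor only.\<close>
    define z where "z = x \<oplus> e \<otimes> (y \<ominus> x)"
    have "y \<ominus> x \<in> I"
      using x y by (simp add: minus_eq)
    then have z: "z \<in> I"
      using x e I.I_l_closed by (simp add: z_def)
    have "\<phi> l z = \<one>\<^bsub>T l\<^esub>" if l: "l \<in> insert k L" for l
    proof -
      have lK: "l \<in> K"
        using l insert.prems by blast
      interpret l: ring_hom_ring R "T l" "\<phi> l"
        using hom_ring[OF lK] .
      have c: "\<phi> l x \<in> carrier (T l)"
        using xy by simp
      have v: "\<phi> l z = \<phi> l x \<oplus>\<^bsub>T l\<^esub> \<phi> l e \<otimes>\<^bsub>T l\<^esub> (\<phi> l y \<ominus>\<^bsub>T l\<^esub> \<phi> l x)"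
        using xy e by (simp add: z_def)
      show ?thesis
      proof (cases "l = k")
        case True
        have "\<phi> l x \<oplus>\<^bsub>T l\<^esub> (\<one>\<^bsub>T l\<^esub> \<ominus>\<^bsub>T l\<^esub> \<phi> l x) = \<one>\<^bsub>T l\<^esub>"
          using c by algebra
        then show ?thesis
          using v e(2)[OF lK] y True c
          by (metis l.S.l_one l.S.minus_closed l.S.one_closed)
      next
        case False
        then show ?thesis
          using v e(2)[OF lK] x l xy by simp
      qed
    qed
    then show ?case
      using z by blast
  qed
  then obtain x where x: "x \<in> I" "\<forall>k\<in>K. \<phi> k x = \<one>\<^bsub>T k\<^esub>"
    using fin_K by blast
  have "\<one> \<ominus> x \<in> jacobson_radical R"
  proof (rule kernel)
    show "\<one> \<ominus> x \<in> carrier R"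
      using x I.a_subset by auto
    fix k assume k: "k \<in> K"
    interpret k: ring_hom_ring R "T k" "\<phi> k"
      using hom_ring[OF k] .
    show "\<phi> k (\<one> \<ominus> x) = \<zero>\<^bsub>T k\<^esub>"
      using x k I.a_subset by (auto simp: k.S.minus_eq k.S.r_neg)
  qed
  then show False
    using ideal_comaximal_radical[OF fin_R I x(1)] ne by blast
qed

end

text \<open>
  The isomorphism identifies the joint fibres of the projections with the cosets of the radical, which
  all have the size of the radical, and the fibre of zero with the radical itself.
\<close>

lemma (in ring) wedderburn_decomposition:
  fixes T :: "nat \<Rightarrow> ('c, 'd) ring_scheme"
  assumes fin: "finite (carrier R)"
    and iso: "R Quot (jacobson_radical R) \<simeq> RDirProd_list (map T [1..<Suc d])"
    and simple: "\<And>k. k \<in> {1..d} \<Longrightarrow> simple_ring (T k)"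
  shows "\<exists>\<phi>. wedderburn_quotients R {1..d} T \<phi> (card (jacobson_radical R))"
proof -
  let ?J = "jacobson_radical R" and ?Rs = "map T [1..<Suc d]"
  interpret J: ideal ?J R
    by (rule jacobson_radical_ideal)
  obtain h where h: "h \<in> ring_hom (R Quot ?J) (RDirProd_list ?Rs)"
    and bij: "bij_betw h (carrier (R Quot ?J)) (carrier (RDirProd_list ?Rs))"
    using iso by (auto simp: is_ring_iso_def ring_iso_def)
  \<comment> \<open>The factors are numbered from \<open>1\<close>, list positions from \<open>0\<close>.\<close>
  define \<phi> where "\<phi> k r = h (?J +> r) ! (k - 1)" for k r
  have idx: "k - 1 < length ?Rs" "?Rs ! (k - 1) = T k" if "k \<in> {1..d}" for k
    using that by (auto simp del: upt_Suc)
  have car_quot: "?J +> r \<in> carrier (R Quot ?J)" if "r \<in> carrier R" for r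
    using ring_hom_closed[OF J.rcos_ring_hom that] .
  have hom: "\<phi> k \<in> ring_hom R (T k)" if k: "k \<in> {1..d}" for k
  proof -
    have "(\<lambda>xs. xs ! (k - 1)) \<circ> (h \<circ> (+>) ?J) \<in> ring_hom R (T k)"
      using ring_hom_trans[OF ring_hom_trans[OF J.rcos_ring_hom h] RDirProd_list_nth_hom[OF idx(1)[OF k]]]
        idx(2)[OF k] by simp
    then show ?thesis
      by (simp add: \<phi>_def[abs_def] comp_def)
  qed
  have fibre: "\<exists>C\<in>carrier (R Quot ?J). {r \<in> carrier R. \<forall>k\<in>{1..d}. \<phi> k r = y k} = C"
    if y: "y \<in> (\<Pi>\<^sub>E k\<in>{1..d}. carrier (T k))" for y
  proof -
    define ys where "ys = map y [1..<Suc d]"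
    have "ys \<in> carrier (RDirProd_list ?Rs)"
      using y by (intro RDirProd_list_carrier_memI) (auto simp: ys_def simp del: upt_Suc)
    then obtain C where C: "C \<in> carrier (R Quot ?J)" "h C = ys"
      using bij by (metis bij_betw_imp_surj_on imageE)
    have "(\<forall>k\<in>{1..d}. \<phi> k r = y k) \<longleftrightarrow> r \<in> C" if r: "r \<in> carrier R" for r
    proof -
      have len: "length (h (?J +> r)) = d"
        using RDirProd_list_carrier_mem(1)[OF ring_hom_closed[OF h car_quot[OF r]]] by simp
      have "(\<forall>k\<in>{1..d}. \<phi> k r = y k) \<longleftrightarrow> (\<forall>k\<in>Suc ` {..<d}. \<phi> k r = y k)"
        by (simp only: image_Suc_lessThan)
      also have "\<dots> \<longleftrightarrow> (\<forall>l<d. h (?J +> r) ! l = y (Suc l))"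
        by (auto simp: \<phi>_def)
      also have "\<dots> \<longleftrightarrow> h (?J +> r) = ys"
        using len by (auto simp: ys_def list_eq_iff_nth_eq simp del: upt_Suc)
      also have "\<dots> \<longleftrightarrow> ?J +> r = C"
        using C bij car_quot[OF r] by (metis bij_betw_inv_into_left)
      also have "\<dots> \<longleftrightarrow> r \<in> C"
      proof
        assume "?J +> r = C"
        then show "r \<in> C"
          using J.a_rcos_self[OF r] by blast
      next
        assume rC: "r \<in> C"
        obtain s where s: "s \<in> carrier R" "C = ?J +> s"
          using C(1) by (auto simp: FactRing_simps)
        then show "?J +> r = C"
          using rC J.a_repr_independence'[of r s] by auto
      qed
      finally show ?thesis .
    qed
    moreover have "C \<subseteq> carrier R"
      using C(1) J.a_rcosets_carrier by (auto simp: FactRing_def)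
    ultimately show ?thesis
      using C(1) by blast
  qed
  have "wedderburn_quotients R {1..d} T \<phi> (card ?J)"
  proof (intro wedderburn_quotients.intro ring_axioms wedderburn_quotients_axioms.intro)
    show "card {r \<in> carrier R. \<forall>k\<in>{1..d}. \<phi> k r = y k} = card ?J"
      if "y \<in> (\<Pi>\<^sub>E k\<in>{1..d}. carrier (T k))" for y
    proof -
      obtain C where "C \<in> carrier (R Quot ?J)" "{r \<in> carrier R. \<forall>k\<in>{1..d}. \<phi> k r = y k} = C"
        using fibre[OF \<open>y \<in> _\<close>] by blast
      then show ?thesis
        using fin a_card_cosets_equal[of C] J.a_subset by (simp add: FactRing_def)
    qed
    show "0 < card ?J"
      using J.a_subset J.zero_closed fin by (metis card_gt_0_iff empty_iff finite_subset)
    fix r assume r: "r \<in> carrier R" and z: "\<And>k. k \<in> {1..d} \<Longrightarrow> \<phi> k r = \<zero>\<^bsub>T k\<^esub>"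
    define y where "y = (\<lambda>k\<in>{1..d}. \<zero>\<^bsub>T k\<^esub>)"
    have y: "y \<in> (\<Pi>\<^sub>E k\<in>{1..d}. carrier (T k))"
      using simple by (auto simp: y_def simple_ring_def intro: ring.ring_simprules)
    obtain C where C: "C \<in> carrier (R Quot ?J)" "{r \<in> carrier R. \<forall>k\<in>{1..d}. \<phi> k r = y k} = C"
      using fibre[OF y] by blast
    have zero: "\<phi> k \<zero> = \<zero>\<^bsub>T k\<^esub>" if "k \<in> {1..d}" for k
    proof -
      interpret k: ring_hom_ring R "T k" "\<phi> k"
        using hom simple that ring_axioms by (intro ring_hom_ringI2) (auto simp: simple_ring_def)
      show ?thesis
        by simp
    qed
    have "\<zero> \<in> C" "r \<in> C"
      using C(2) r z zero by (auto simp: y_def)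
    moreover obtain s where s: "s \<in> carrier R" "C = ?J +> s"
      using C(1) by (auto simp: FactRing_simps)
    ultimately have "C = ?J +> \<zero>"
      using J.a_repr_independence'[of \<zero> s] by auto
    then have "C = ?J"
      using J.a_subset by (simp add: a_coset_add_zero)
    then show "r \<in> ?J"
      using \<open>r \<in> C\<close> by simp
  qed (use fin hom simple in auto)
  then show ?thesis
    by blast
qed

section \<open>Matrix rings over a field\<close>

definition mat_unit :: "nat \<Rightarrow> ('a, 'b) ring_scheme \<Rightarrow> nat \<Rightarrow> nat \<Rightarrow> 'a \<Rightarrow> nat \<times> nat \<Rightarrow> 'a" where
  "mat_unit n R a b x = (\<lambda>p\<in>{1..n} \<times> {1..n}. if p = (a, b) then x else \<zero>\<^bsub>R\<^esub>)"

context ring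
begin

lemma mat_unit_closed: "x \<in> carrier R \<Longrightarrow> mat_unit n R a b x \<in> carrier (mat_ring n R)"
  by (auto simp: mat_unit_def mat_carrier)

lemma mat_unit_entry:
  "\<lbrakk>i \<in> {1..n}; j \<in> {1..n}\<rbrakk> \<Longrightarrow> mat_unit n R a b x (i, j) = (if i = a \<and> j = b then x else \<zero>)"
  by (simp add: mat_unit_def)

lemma mat_unit_mult_entry:
  assumes A: "A \<in> carrier (mat_ring n R)" and x: "x \<in> carrier R"
    and ab: "a \<in> {1..n}" "b \<in> {1..n}" and ij: "i \<in> {1..n}" "j \<in> {1..n}"
  shows "(mat_unit n R a b x \<otimes>\<^bsub>mat_ring n R\<^esub> A) (i, j) = (if i = a then x \<otimes> A (b, j) else \<zero>)"
    and "(A \<otimes>\<^bsub>mat_ring n R\<^esub> mat_unit n R a b x) (i, j) = (if j = b then A (i, a) \<otimes> x else \<zero>)"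
proof -
  note D = mat_in_carrierD[OF A]
  have "(\<Oplus>k\<in>{1..n}. mat_unit n R a b x (i, k) \<otimes> A (k, j)) = mat_unit n R a b x (i, b) \<otimes> A (b, j)"
    using x ab ij by (intro finsum_single_term) (auto simp: mat_unit_entry D)
  then show "(mat_unit n R a b x \<otimes>\<^bsub>mat_ring n R\<^esub> A) (i, j) = (if i = a then x \<otimes> A (b, j) else \<zero>)"
    using x ab ij by (simp add: mat_mult_entry mat_unit_entry D)
  have "(\<Oplus>k\<in>{1..n}. A (i, k) \<otimes> mat_unit n R a b x (k, j)) = A (i, a) \<otimes> mat_unit n R a b x (a, j)"
    using x ab ij by (intro finsum_single_term) (auto simp: mat_unit_entry D)
  then show "(A \<otimes>\<^bsub>mat_ring n R\<^esub> mat_unit n R a b x) (i, j) = (if j = b then A (i, a) \<otimes> x else \<zero>)"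
    using x ab ij by (simp add: mat_mult_entry mat_unit_entry D)
qed

end

text \<open>
  If the entry \<open>A (a, b)\<close> is nonzero, then \<open>E\<^sub>i\<^sub>a A E\<^sub>b\<^sub>i\<close>, divided by that entry, is the diagonal matrix unit at
  \<open>i\<close>; the sum of these over \<open>i\<close> is the identity.
\<close>

lemma (in field) mat_ring_simple:
  assumes n: "n \<ge> 1"
  shows "simple_ring (mat_ring n R)"
proof -
  interpret M: ring "mat_ring n R"
    by (rule mat_ring_is_ring)
  have "\<one>\<^bsub>mat_ring n R\<^esub> (1, 1) \<noteq> \<zero>\<^bsub>mat_ring n R\<^esub> (1, 1)"
    using n by (simp add: mat_entries)
  then have ne: "\<one>\<^bsub>mat_ring n R\<^esub> \<noteq> \<zero>\<^bsub>mat_ring n R\<^esub>"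
    by metis
  have "I = carrier (mat_ring n R)" if I: "ideal I (mat_ring n R)" and nz: "I \<noteq> {\<zero>\<^bsub>mat_ring n R\<^esub>}" for I
  proof -
    interpret I: ideal I "mat_ring n R"
      by (rule I)
    obtain A where A: "A \<in> I" "A \<noteq> \<zero>\<^bsub>mat_ring n R\<^esub>"
      using nz I.zero_closed by blast
    have Ac: "A \<in> carrier (mat_ring n R)"
      using A(1) I.a_subset by blast
    obtain a b where ab: "a \<in> {1..n}" "b \<in> {1..n}" "A (a, b) \<noteq> \<zero>"
    proof (rule ccontr)
      assume "\<not> thesis"
      then have "A = \<zero>\<^bsub>mat_ring n R\<^esub>"
        using that by (intro mat_eqI[OF Ac M.zero_closed]) (auto simp: mat_zero_entry)
      then show False
        using A(2) by simp
    qed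
    define y where "y = inv (A (a, b))"
    have unit: "A (a, b) \<in> Units R"
      using mat_in_carrierD[OF Ac ab(1,2)] ab(3) by (simp add: field_Units)
    have y: "y \<in> carrier R" "y \<otimes> A (a, b) = \<one>"
      using unit by (simp_all add: y_def)
    have E: "mat_unit n R i i \<one> \<in> I" if i: "i \<in> {1..n}" for i
    proof -
      let ?L = "mat_unit n R i a y" and ?Q = "mat_unit n R b i \<one>"
      have L: "?L \<otimes>\<^bsub>mat_ring n R\<^esub> A \<in> I"
        using I.I_l_closed[OF A(1) mat_unit_closed[OF y(1)]] .
      then have Lc: "?L \<otimes>\<^bsub>mat_ring n R\<^esub> A \<in> carrier (mat_ring n R)"
        using I.a_subset by blast
      have LQ: "(?L \<otimes>\<^bsub>mat_ring n R\<^esub> A) \<otimes>\<^bsub>mat_ring n R\<^esub> ?Q \<in> I"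
        using I.I_r_closed[OF L mat_unit_closed[OF one_closed]] .
      have "mat_unit n R i i \<one> = (?L \<otimes>\<^bsub>mat_ring n R\<^esub> A) \<otimes>\<^bsub>mat_ring n R\<^esub> ?Q"
      proof (rule mat_eqI)
        show "mat_unit n R i i \<one> \<in> carrier (mat_ring n R)"
          by (simp add: mat_unit_closed)
        show "(?L \<otimes>\<^bsub>mat_ring n R\<^esub> A) \<otimes>\<^bsub>mat_ring n R\<^esub> ?Q \<in> carrier (mat_ring n R)"
          using LQ I.a_subset by blast
        fix u v assume uv: "u \<in> {1..n}" "v \<in> {1..n}"
        show "mat_unit n R i i \<one> (u, v) = ((?L \<otimes>\<^bsub>mat_ring n R\<^esub> A) \<otimes>\<^bsub>mat_ring n R\<^esub> ?Q) (u, v)"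
          unfolding mat_unit_mult_entry(2)[OF Lc one_closed ab(2) i uv]
            mat_unit_mult_entry(1)[OF Ac y(1) i ab(1) uv(1) ab(2)] mat_unit_entry[OF uv]
          using y by auto
      qed
      then show ?thesis
        using LQ by simp
    qed
    define diag where "diag L = (\<lambda>(i, j)\<in>{1..n} \<times> {1..n}. if i = j \<and> i \<in> L then \<one> else \<zero>)" for L
    have diagc: "diag L \<in> carrier (mat_ring n R)" for L
      by (auto simp: diag_def mat_carrier)
    have "diag L \<in> I" if "finite L" "L \<subseteq> {1..n}" for L
      using that
    proof (induction L rule: finite_induct)
      case empty
      have "diag {} = \<zero>\<^bsub>mat_ring n R\<^esub>"
        by (rule mat_eqI[OF diagc M.zero_closed]) (auto simp: diag_def mat_zero_entry)
      then show ?case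
        using I.zero_closed by simp
    next
      case (insert i L)
      have "diag (insert i L) = diag L \<oplus>\<^bsub>mat_ring n R\<^esub> mat_unit n R i i \<one>"
        using insert(2)
        by (intro mat_eqI[OF diagc M.a_closed[OF diagc mat_unit_closed[OF one_closed]]])
          (auto simp: diag_def mat_add_entry mat_unit_entry)
      then show ?case
        using insert E[of i] I.a_closed by simp
    qed
    then have "diag {1..n} \<in> I"
      by simp
    moreover have "diag {1..n} = \<one>\<^bsub>mat_ring n R\<^esub>"
      by (rule mat_eqI[OF diagc M.one_closed]) (auto simp: diag_def mat_one_entry)
    ultimately show ?thesis
      using I.one_imp_carrier by simp
  qed
  then show ?thesis
    using ne M.ring_axioms by (auto simp: simple_ring_def)
qed

text \<open>
  The centre consists of the scalar matrices: compare a central matrix with the matrix units \<open>E\<^sub>j\<^sub>1\<close>.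
\<close>

lemma (in field) card_mat_ring_center:
  assumes n: "n \<ge> 1"
  shows "card (ring_center (mat_ring n R)) = card (carrier R)"
proof -
  interpret M: ring "mat_ring n R"
    by (rule mat_ring_is_ring)
  define sc where "sc x = (\<lambda>(i, j)\<in>{1..n} \<times> {1..n}. if i = j then x else \<zero>)" for x
  have sc_closed: "sc x \<in> carrier (mat_ring n R)" if "x \<in> carrier R" for x
    using that by (auto simp: sc_def mat_carrier)
  have sc_entry: "sc x (i, j) = (if i = j then x else \<zero>)" if "i \<in> {1..n}" "j \<in> {1..n}" for x i j
    using that by (simp add: sc_def)
  have "inj_on sc (carrier R)"
  proof (rule inj_onI)
    fix x y assume "sc x = sc y"
    then have "sc x (1, 1) = sc y (1, 1)"
      by simp
    then show "x = y"
      using n by (simp add: sc_entry)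
  qed
  moreover have "sc ` carrier R = ring_center (mat_ring n R)"
  proof
    show "sc ` carrier R \<subseteq> ring_center (mat_ring n R)"
    proof
      fix z assume "z \<in> sc ` carrier R"
      then obtain x where x: "x \<in> carrier R" and z: "z = sc x"
        by blast
      have "A \<otimes>\<^bsub>mat_ring n R\<^esub> sc x = sc x \<otimes>\<^bsub>mat_ring n R\<^esub> A" if A: "A \<in> carrier (mat_ring n R)" for A
      proof (rule mat_eqI)
        fix i j assume ij: "i \<in> {1..n}" "j \<in> {1..n}"
        note D = mat_in_carrierD[OF A]
        have "(\<Oplus>k\<in>{1..n}. A (i, k) \<otimes> sc x (k, j)) = A (i, j) \<otimes> sc x (j, j)"
          using x ij by (intro finsum_single_term) (auto simp: sc_entry D)
        moreover have "(\<Oplus>k\<in>{1..n}. sc x (i, k) \<otimes> A (k, j)) = sc x (i, i) \<otimes> A (i, j)"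
          using x ij by (intro finsum_single_term) (auto simp: sc_entry D)
        ultimately show "(A \<otimes>\<^bsub>mat_ring n R\<^esub> sc x) (i, j) = (sc x \<otimes>\<^bsub>mat_ring n R\<^esub> A) (i, j)"
          using ij x by (simp add: mat_mult_entry sc_entry D m_comm)
      qed (use A sc_closed[OF x] in auto)
      then show "z \<in> ring_center (mat_ring n R)"
        using sc_closed[OF x] z by (simp add: ring_center_def)
    qed
    show "ring_center (mat_ring n R) \<subseteq> sc ` carrier R"
    proof
      fix z assume "z \<in> ring_center (mat_ring n R)"
      then have z: "z \<in> carrier (mat_ring n R)"
        and comm: "\<And>A. A \<in> carrier (mat_ring n R) \<Longrightarrow> A \<otimes>\<^bsub>mat_ring n R\<^esub> z = z \<otimes>\<^bsub>mat_ring n R\<^esub> A"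
        by (auto simp: ring_center_def)
      have one: "1 \<in> {1..n}"
        using n by simp
      have x: "z (1, 1) \<in> carrier R"
        using mat_in_carrierD[OF z one one] .
      have entry: "z (i, j) = (if i = j then z (1, 1) else \<zero>)" if ij: "i \<in> {1..n}" "j \<in> {1..n}" for i j
      proof -
        let ?E = "mat_unit n R j 1 \<one>"
        have "(?E \<otimes>\<^bsub>mat_ring n R\<^esub> z) (i, 1) = (z \<otimes>\<^bsub>mat_ring n R\<^esub> ?E) (i, 1)"
          using comm[OF mat_unit_closed[OF one_closed]] by simp
        then show ?thesis
          unfolding mat_unit_mult_entry[OF z one_closed ij(2) one ij(1) one]
          using x mat_in_carrierD[OF z ij] by (simp split: if_splits)
      qed
      have "z = sc (z (1, 1))"
      proof (rule mat_eqI[OF z sc_closed[OF x]])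
        fix i j assume ij: "i \<in> {1..n}" "j \<in> {1..n}"
        show "z (i, j) = sc (z (1, 1)) (i, j)"
          unfolding sc_entry[OF ij] by (rule entry[OF ij])
      qed
      then show "z \<in> sc ` carrier R"
        using x by blast
    qed
  qed
  ultimately show ?thesis
    by (metis card_image)
qed

lemma card_mat_ring: "card (carrier (mat_ring n R)) = card (carrier R) ^ (n\<^sup>2)"
  by (simp add: mat_carrier card_funcsetE card_cartesian_product power2_eq_square)

section \<open>Counting\<close>

text \<open>
  The annihilator of the central element \<open>z - z'\<close> is a two-sided ideal, and it contains \<open>x \<noteq> 0\<close>,
  hence also \<open>1\<close>.
\<close>

lemma simple_ring_center_cancel:
  assumes T: "simple_ring T" and x: "x \<in> carrier T" "x \<noteq> \<zero>\<^bsub>T\<^esub>"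
    and z: "z \<in> ring_center T" "z' \<in> ring_center T" and eq: "x \<otimes>\<^bsub>T\<^esub> z = x \<otimes>\<^bsub>T\<^esub> z'"
  shows "z = z'"
proof -
  interpret ring T
    using T by (simp add: simple_ring_def)
  define d where "d = z \<ominus>\<^bsub>T\<^esub> z'"
  have zc: "z \<in> carrier T" "z' \<in> carrier T"
    using z by (auto simp: ring_center_def)
  have d: "d \<in> carrier T"
    using zc by (simp add: d_def)
  have comm: "y \<otimes>\<^bsub>T\<^esub> d = d \<otimes>\<^bsub>T\<^esub> y" if "y \<in> carrier T" for y
    using z zc that by (auto simp: d_def ring_center_def minus_eq r_distr l_distr r_minus l_minus)
  define I where "I = {y \<in> carrier T. y \<otimes>\<^bsub>T\<^esub> d = \<zero>\<^bsub>T\<^esub>}"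
  have "ideal I T"
  proof (rule idealI)
    show "subgroup I (add_monoid T)"
      using d by (intro add.subgroupI) (auto simp: I_def l_distr l_minus)
    fix a y assume a: "a \<in> I" and y: "y \<in> carrier T"
    then have "a \<in> carrier T"
      by (simp add: I_def)
    then have "a \<otimes>\<^bsub>T\<^esub> y \<otimes>\<^bsub>T\<^esub> d = a \<otimes>\<^bsub>T\<^esub> d \<otimes>\<^bsub>T\<^esub> y"
      using y d comm[OF y] by (simp add: m_assoc)
    then show "a \<otimes>\<^bsub>T\<^esub> y \<in> I"
      using a y d by (simp add: I_def)
    show "y \<otimes>\<^bsub>T\<^esub> a \<in> I"
      using a y d by (simp add: I_def m_assoc)
  qed (rule ring_axioms)
  moreover have "x \<in> I"
    using x zc eq by (simp add: I_def d_def minus_eq r_distr r_minus r_neg)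
  ultimately have "I = carrier T"
    using T x unfolding simple_ring_def by blast
  then have "\<one>\<^bsub>T\<^esub> \<in> I"
    by simp
  then have "d = \<zero>\<^bsub>T\<^esub>"
    using d by (simp add: I_def)
  then show ?thesis
    using zc by (simp add: d_def)
qed

lemma card_constant_fibres:
  assumes D: "finite D" and Y: "finite Y" and f: "\<And>x. x \<in> D \<Longrightarrow> f x \<in> Y"
    and c: "\<And>y. y \<in> Y \<Longrightarrow> card {x \<in> D. f x = y} = c"
  shows "card {x \<in> D. P (f x)} = c * card {y \<in> Y. P y}"
proof -
  have "{x \<in> D. P (f x)} = (\<Union>y\<in>{y \<in> Y. P y}. {x \<in> D. f x = y})"
    using f by auto
  also have "card \<dots> = (\<Sum>y\<in>{y \<in> Y. P y}. card {x \<in> D. f x = y})"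
    using D Y by (intro card_UN_disjoint) auto
  also have "\<dots> = (\<Sum>y\<in>{y \<in> Y. P y}. c)"
    using c by (intro sum.cong) auto
  finally show ?thesis
    by simp
qed

context incidence
begin

definition covers :: "nat rel" where
  "covers = {(i, j). covered_by po i j}"

lemma covers_subset: "covers \<subseteq> po"
  using cover_facts by (auto simp: covers_def)

lemma finite_po: "finite po"
  using partial_order_onD(4)[OF po] by (rule finite_subset) simp

text \<open>
  Read off the diagonal first: it is an arbitrary injection into \<open>V\<close>. Given the diagonal, the other
  labels are independent, a cover having \<open>q\<close> forbidden values and the remaining pairs none.
\<close>

lemma card_labellings:
  fixes L :: "'v \<Rightarrow> 'v \<Rightarrow> 'v set"
  assumes V: "finite V" and L: "\<And>v w. \<lbrakk>v \<in> V; w \<in> V; v \<noteq> w\<rbrakk> \<Longrightarrow> L v w \<subseteq> V \<and> card (L v w) = q"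
  shows "card {g \<in> po \<rightarrow>\<^sub>E V. inj_on (\<lambda>i. g (i, i)) {1..n} \<and>
        (\<forall>i j. covered_by po i j \<longrightarrow> g (i, j) \<notin> L (g (i, i)) (g (j, j)))} =
      (\<Prod>l\<in>{0..<n}. card V - l) * ((card V - q) ^ card covers * card V ^ (card po - n - card covers))"
    (is "card ?X = _")
proof -
  define f :: "(nat \<times> nat \<Rightarrow> 'v) \<Rightarrow> nat \<Rightarrow> 'v" where "f g = (\<lambda>i\<in>{1..n}. g (i, i))" for g
  define Y where "Y = {e \<in> {1..n} \<rightarrow>\<^sub>E V. inj_on e {1..n}}"
  define D where "D = (\<lambda>i. (i, i)) ` {1..n}"
  define c where "c = (card V - q) ^ card covers * card V ^ (card po - n - card covers)"
  have cardD: "card D = n"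
    unfolding D_def by (subst card_image) (auto simp: inj_on_def)
  have D: "D \<subseteq> po" "D \<inter> covers = {}"
    using po_refl cover_facts(3) by (auto simp: D_def covers_def)
  have fibre: "card {g \<in> ?X. f g = e} = c" if e: "e \<in> Y" for e
  proof -
    define S where "S = (\<lambda>(i, j). if i = j then {e i} else if (i, j) \<in> covers then V - L (e i) (e j) else V)"
    have e_eq: "f g = e \<longleftrightarrow> (\<forall>i\<in>{1..n}. g (i, i) = e i)" for g
    proof
      assume eq: "\<forall>i\<in>{1..n}. g (i, i) = e i"
      have "e \<in> extensional {1..n}"
        using e by (simp add: Y_def PiE_def)
      then show "f g = e"
        using eq by (intro extensionalityI[of _ "{1..n}"]) (auto simp: f_def)
    qed (auto simp: f_def)
    have ev: "e i \<in> V" if "i \<in> {1..n}" for i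
      using e that by (auto simp: Y_def)
    have "{g \<in> ?X. f g = e} = PiE po S"
    proof (intro Set.set_eqI iffI)
      fix g assume g: "g \<in> {g \<in> ?X. f g = e}"
      then have gd: "g (i, i) = e i" if "i \<in> {1..n}" for i
        using e_eq[of g] that by blast
      have gV: "g \<in> po \<rightarrow>\<^sub>E V" and gc: "covered_by po i j \<Longrightarrow> g (i, j) \<notin> L (g (i, i)) (g (j, j))" for i j
        using g by blast+
      show "g \<in> PiE po S"
      proof (rule PiE_I)
        fix p assume p: "p \<in> po"
        obtain i j where ij: "p = (i, j)"
          by fastforce
        have r: "i \<in> {1..n}" "j \<in> {1..n}"
          using p ij po_range by blast+
        have "g p \<in> V"
          using gV p by blast
        then show "g p \<in> S p"
          using ij gd[OF r(1)] gd[OF r(2)] gc[of i j] by (auto simp: S_def covers_def)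
      next
        fix p assume "p \<notin> po"
        then show "g p = undefined"
          using gV by (rule PiE_arb[rotated])
      qed
    next
      fix g assume g: "g \<in> PiE po S"
      have gS: "g (i, j) \<in> S (i, j)" if "(i, j) \<in> po" for i j
        using g that by blast
      have gd: "g (i, i) = e i" if "i \<in> {1..n}" for i
        using gS[OF po_refl[OF that]] by (simp add: S_def)
      have "g \<in> po \<rightarrow>\<^sub>E V"
      proof (rule PiE_I)
        fix p assume p: "p \<in> po"
        obtain i j where ij: "p = (i, j)"
          by fastforce
        then show "g p \<in> V"
          using gS[of i j] p po_range[of i j] ev by (auto simp: S_def split: if_splits)
      next
        fix p assume "p \<notin> po"
        then show "g p = undefined"
          using g by (rule PiE_arb[rotated])
      qed
      moreover have "inj_on (\<lambda>i. g (i, i)) {1..n}"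
      proof -
        have "inj_on e {1..n}"
          using e by (simp add: Y_def)
        then show ?thesis
          by (rule inj_on_cong[THEN iffD1, rotated]) (simp only: gd)
      qed
      moreover have "g (i, j) \<notin> L (g (i, i)) (g (j, j))" if cov: "covered_by po i j" for i j
        using gS[of i j] cover_facts[OF cov] gd cov by (auto simp: S_def covers_def)
      ultimately show "g \<in> {g \<in> ?X. f g = e}"
        using gd e_eq[of g] by blast
    qed
    then have "card {g \<in> ?X. f g = e} = (\<Prod>p\<in>po. card (S p))"
      by (simp add: card_PiE finite_po)
    also have "\<dots> = (\<Prod>p\<in>po. if p \<in> D then 1 else if p \<in> covers then card V - q else card V)"
    proof (rule prod.cong)
      fix p assume p: "p \<in> po"
      obtain i j where ij: "p = (i, j)"
        by fastforce
      have r: "i \<in> {1..n}" "j \<in> {1..n}"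
        using p ij po_range by blast+
      show "card (S p) = (if p \<in> D then 1 else if p \<in> covers then card V - q else card V)"
      proof (cases "i = j")
        case True
        then show ?thesis
          using r ij by (auto simp: S_def D_def)
      next
        case False
        moreover have "inj_on e {1..n}"
          using e by (simp add: Y_def)
        ultimately have "e i \<noteq> e j"
          using r by (meson inj_onD)
        then have "L (e i) (e j) \<subseteq> V" "card (L (e i) (e j)) = q"
          using L[OF ev[OF r(1)] ev[OF r(2)]] by simp_all
        then have "card (V - L (e i) (e j)) = card V - q"
          using V by (metis card_Diff_subset finite_subset)
        then show ?thesis
          using ij False by (auto simp: S_def D_def)
      qed
    qed simp
    also have "\<dots> = (\<Prod>p\<in>po - D. if p \<in> covers then card V - q else card V)"
      using D finite_po by (intro prod.mono_neutral_cong_right) auto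
    also have "\<dots> = (card V - q) ^ card ((po - D) \<inter> covers) * card V ^ card ((po - D) \<inter> - covers)"
      using finite_po by (simp add: prod.If_cases)
    also have "(po - D) \<inter> covers = covers"
      using D covers_subset by blast
    also have "(po - D) \<inter> - covers = po - D - covers"
      by blast
    also have "card (po - D - covers) = card po - n - card covers"
    proof -
      have "finite D" "finite covers"
        using D(1) covers_subset finite_po by (auto intro: finite_subset)
      moreover have "covers \<subseteq> po - D"
        using D covers_subset by blast
      ultimately show ?thesis
        using D(1) cardD by (simp add: card_Diff_subset)
    qed
    finally show ?thesis
      by (simp add: c_def)
  qed
  have finX: "finite ?X"
    by (rule finite_subset[of _ "po \<rightarrow>\<^sub>E V"]) (auto intro: finite_PiE finite_po V)
  have finY: "finite Y"
    by (rule finite_subset[of _ "{1..n} \<rightarrow>\<^sub>E V"]) (auto simp: Y_def intro: finite_PiE V)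
  have fX: "f g \<in> Y" if g: "g \<in> ?X" for g
  proof -
    have "g \<in> po \<rightarrow>\<^sub>E V" and inj: "inj_on (\<lambda>i. g (i, i)) {1..n}"
      using g by blast+
    then have "f g \<in> {1..n} \<rightarrow>\<^sub>E V"
      unfolding f_def using po_refl by (intro restrict_PiE[THEN iffD2] Pi_I) blast
    moreover have "inj_on (f g) {1..n}"
      using inj by (rule inj_on_cong[THEN iffD1, rotated]) (simp add: f_def)
    ultimately show ?thesis
      by (simp add: Y_def)
  qed
  have "card ?X = c * card Y"
    using card_constant_fibres[OF finX finY fX fibre, where P = "\<lambda>_. True"] by simp
  also have "card Y = (\<Prod>l\<in>{0..<n}. card V - l)"
    unfolding Y_def using card_inj_on_subset_funcset[of "{1..n}" V "{1..n}"] V by simp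
  finally show ?thesis
    by (simp add: c_def mult.commute)
qed

text \<open>
  Passing from natural to real subtraction needs \<open>n \<le> |V|\<close> and \<open>q \<le> |V|\<close>. If \<open>|V| < n\<close>, then no diagonal is
  injective, and the product on the right has the factor \<open>1 - |V| / |V| = 0\<close>. Otherwise a cover forces
  \<open>|V| \<ge> 2\<close>, so \<open>V\<close> contains a line and \<open>q \<le> |V|\<close>.
\<close>

lemma labelling_probability:
  fixes L :: "'v \<Rightarrow> 'v \<Rightarrow> 'v set"
  assumes n: "n \<ge> 1" and V: "finite V" "V \<noteq> {}"
    and L: "\<And>v w. \<lbrakk>v \<in> V; w \<in> V; v \<noteq> w\<rbrakk> \<Longrightarrow> L v w \<subseteq> V \<and> card (L v w) = q"
  shows "real (card {g \<in> po \<rightarrow>\<^sub>E V. inj_on (\<lambda>i. g (i, i)) {1..n} \<and>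
        (\<forall>i j. covered_by po i j \<longrightarrow> g (i, j) \<notin> L (g (i, i)) (g (j, j)))}) / real (card (po \<rightarrow>\<^sub>E V)) =
      (1 - real q / real (card V)) ^ card covers * (\<Prod>l = 1..n - 1. 1 - real l / real (card V))"
proof -
  define v where "v = card V"
  define r where "r = card po - n - card covers"
  have v: "v > 0"
    using V by (simp add: v_def card_gt_0_iff)
  have "card po = n + card covers + r"
  proof -
    define D where "D = (\<lambda>i. (i, i)) ` {1..n}"
    have "card D = n"
      unfolding D_def by (subst card_image) (auto simp: inj_on_def)
    moreover have "D \<union> covers \<subseteq> po" "D \<inter> covers = {}"
      using po_refl cover_facts(3) covers_subset by (auto simp: D_def covers_def)
    ultimately have "n + card covers \<le> card po"
      using finite_po by (metis card_Un_disjoint card_mono finite_Un finite_subset)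
    then show ?thesis
      by (simp add: r_def)
  qed
  then have total: "card (po \<rightarrow>\<^sub>E V) = v ^ n * (v ^ card covers * v ^ r)"
    by (simp add: card_funcsetE finite_po v_def power_add)
  have zero: "{0..<n} = insert 0 {1..n - 1}"
    using n by auto
  have diag: "real (\<Prod>l\<in>{0..<n}. v - l) / real v ^ n = (\<Prod>l = 1..n - 1. 1 - real l / real v)"
  proof (cases "n \<le> v")
    case True
    have "real (\<Prod>l\<in>{0..<n}. v - l) / real v ^ n = (\<Prod>l\<in>{0..<n}. real (v - l) / real v)"
      by (simp add: prod_dividef)
    also have "\<dots> = (\<Prod>l\<in>{0..<n}. 1 - real l / real v)"
      using True v by (intro prod.cong) (auto simp: field_simps of_nat_diff)
    finally show ?thesis
      unfolding zero by simp
  next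
    case False
    then have "(\<Prod>l\<in>{0..<n}. v - l) = 0"
      by (intro prod_zero bexI[of _ v]) auto
    moreover have "(\<Prod>l = 1..n - 1. 1 - real l / real v) = 0"
      using v False by (intro prod_zero bexI[of _ v]) auto
    ultimately show ?thesis
      by (simp only: of_nat_0 div_0)
  qed
  have "(\<Prod>l = 1..n - 1. 1 - real l / real v) * (real (v - q) ^ card covers / real v ^ card covers) =
      (\<Prod>l = 1..n - 1. 1 - real l / real v) * (1 - real q / real v) ^ card covers"
  proof (cases "n \<le> v \<and> card covers \<noteq> 0")
    case True
    then obtain i j where "(i, j) \<in> covers"
      by (metis card.empty ex_in_conv surj_pair)
    then have "i \<in> {1..n}" "j \<in> {1..n}" "i \<noteq> j"
      using cover_facts by (auto simp: covers_def)
    then have "v \<ge> 2"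
      using True by auto
    then obtain x y where "x \<in> V" "y \<in> V" "x \<noteq> y"
      unfolding v_def by (metis V(1) card_le_Suc0_iff_eq not_less_eq_eq numeral_2_eq_2)
    then have "q \<le> v"
      using L[of x y] V(1) card_mono unfolding v_def by metis
    then have "real (v - q) / real v = 1 - real q / real v"
      using v by (simp add: field_simps of_nat_diff)
    then show ?thesis
      by (simp add: power_divide[symmetric])
  next
    case False
    then consider "card covers = 0" | "v < n"
      by linarith
    then show ?thesis
    proof cases
      case 2
      then have "(\<Prod>l = 1..n - 1. 1 - real l / real v) = 0"
        using v by (intro prod_zero bexI[of _ v]) auto
      then show ?thesis
        by (simp only: mult_zero_left)
    qed simp
  qed
  note cover = this
  have "card {g \<in> po \<rightarrow>\<^sub>E V. inj_on (\<lambda>i. g (i, i)) {1..n} \<and>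
        (\<forall>i j. covered_by po i j \<longrightarrow> g (i, j) \<notin> L (g (i, i)) (g (j, j)))} =
      (\<Prod>l\<in>{0..<n}. v - l) * ((v - q) ^ card covers * v ^ r)" (is "card ?G = _")
    using card_labellings[OF V(1) L] unfolding v_def r_def .
  then have "real (card ?G) / real (card (po \<rightarrow>\<^sub>E V)) =
      (real (\<Prod>l\<in>{0..<n}. v - l) / real v ^ n) * (real (v - q) ^ card covers / real v ^ card covers) *
        (real v ^ r / real v ^ r)"
    unfolding total by simp
  also have "\<dots> = (\<Prod>l = 1..n - 1. 1 - real l / real v) * (1 - real q / real v) ^ card covers"
    unfolding diag cover using v by simp
  finally show ?thesis
    by (simp add: v_def mult.commute)
qed

lemma inc_carrier_PiE:
  "carrier \<A> = (\<Pi>\<^sub>E p\<in>{1..n} \<times> {1..n}. if p \<in> po then carrier R else {\<zero>})"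
proof (intro Set.set_eqI iffI)
  fix A assume A: "A \<in> carrier \<A>"
  show "A \<in> (\<Pi>\<^sub>E p\<in>{1..n} \<times> {1..n}. if p \<in> po then carrier R else {\<zero>})"
  proof (rule PiE_I)
    fix p assume "p \<in> {1..n} \<times> {1..n}"
    then obtain i j where "p = (i, j)" "i \<in> {1..n}" "j \<in> {1..n}"
      by blast
    then show "A p \<in> (if p \<in> po then carrier R else {\<zero>})"
      using A inc_zero[OF A, of i j] by simp
  qed (rule PiE_arb[OF inc_mat[OF A, unfolded mat_carrier]])
next
  fix A assume A: "A \<in> (\<Pi>\<^sub>E p\<in>{1..n} \<times> {1..n}. if p \<in> po then carrier R else {\<zero>})"
  have mem: "A p \<in> (if p \<in> po then carrier R else {\<zero>})" if "p \<in> {1..n} \<times> {1..n}" for p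
    using PiE_mem[OF A that] .
  have "A \<in> carrier (mat_ring n R)"
    unfolding mat_carrier
  proof (rule PiE_I)
    fix p assume "p \<in> {1..n} \<times> {1..n}"
    then show "A p \<in> carrier R"
      using mem[of p] by (auto split: if_splits)
  qed (rule PiE_arb[OF A])
  moreover have "A (i, j) = \<zero>" if "i \<in> {1..n}" "j \<in> {1..n}" "(i, j) \<notin> po" for i j
    using mem[of "(i, j)"] that by simp
  ultimately show "A \<in> carrier \<A>"
    by (simp add: inc_carrier)
qed

end

text \<open>
  The forbidden labels of a cover: the line through the origin in direction \<open>v - w\<close>, over the centre.
\<close>

definition line :: "nat \<Rightarrow> ('c, 'd) ring_scheme \<Rightarrow> (nat \<Rightarrow> 'c) \<Rightarrow> (nat \<Rightarrow> 'c) \<Rightarrow> (nat \<Rightarrow> 'c) set" where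
  "line m T v w = (\<lambda>z. \<lambda>t\<in>{1..m}. (v t \<ominus>\<^bsub>T\<^esub> w t) \<otimes>\<^bsub>T\<^esub> z) ` ring_center T"

text \<open>
  In a coordinate where \<open>v\<close> and \<open>w\<close> differ, the central multiplier can be cancelled.
\<close>

lemma line_card:
  assumes T: "simple_ring T" and v: "v \<in> {1..m} \<rightarrow>\<^sub>E carrier T" and w: "w \<in> {1..m} \<rightarrow>\<^sub>E carrier T"
    and ne: "v \<noteq> w"
  shows "line m T v w \<subseteq> {1..m} \<rightarrow>\<^sub>E carrier T" "card (line m T v w) = card (ring_center T)"
proof -
  interpret ring T
    using T by (simp add: simple_ring_def)
  have vw: "v t \<in> carrier T" "w t \<in> carrier T" if "t \<in> {1..m}" for t
    using v w that by auto
  have center: "z \<in> carrier T" if "z \<in> ring_center T" for z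
    using that by (simp add: ring_center_def)
  show "line m T v w \<subseteq> {1..m} \<rightarrow>\<^sub>E carrier T"
    using vw center by (auto simp: line_def)
  obtain t where t: "t \<in> {1..m}" "v t \<noteq> w t"
    using ne PiE_ext[OF v w] by blast
  then have x: "v t \<ominus>\<^bsub>T\<^esub> w t \<in> carrier T" "v t \<ominus>\<^bsub>T\<^esub> w t \<noteq> \<zero>\<^bsub>T\<^esub>"
    using vw by auto
  have "inj_on (\<lambda>z. \<lambda>t\<in>{1..m}. (v t \<ominus>\<^bsub>T\<^esub> w t) \<otimes>\<^bsub>T\<^esub> z) (ring_center T)"
  proof (rule inj_onI)
    fix z z' assume z: "z \<in> ring_center T" "z' \<in> ring_center T"
      and eq: "(\<lambda>t\<in>{1..m}. (v t \<ominus>\<^bsub>T\<^esub> w t) \<otimes>\<^bsub>T\<^esub> z) = (\<lambda>t\<in>{1..m}. (v t \<ominus>\<^bsub>T\<^esub> w t) \<otimes>\<^bsub>T\<^esub> z')"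
    have "(v t \<ominus>\<^bsub>T\<^esub> w t) \<otimes>\<^bsub>T\<^esub> z = (v t \<ominus>\<^bsub>T\<^esub> w t) \<otimes>\<^bsub>T\<^esub> z'"
      using fun_cong[OF eq, of t] t(1) by simp
    then show "z = z'"
      by (rule simple_ring_center_cancel[OF T x z])
  qed
  then show "card (line m T v w) = card (ring_center T)"
    unfolding line_def by (rule card_image)
qed

locale incidence_wedderburn = incidence R n po + wedderburn_quotients R K T \<phi> N
  for R :: "('a, 'r) ring_scheme" (structure) and n po and K :: "'k set"
    and T :: "'k \<Rightarrow> ('c, 'd) ring_scheme" and \<phi> N
begin

definition reduction :: "nat \<Rightarrow> (nat \<Rightarrow> nat \<times> nat \<Rightarrow> 'a) \<Rightarrow> 'k \<Rightarrow> nat \<times> nat \<Rightarrow> nat \<Rightarrow> 'c" where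
  "reduction m As = (\<lambda>k\<in>K. \<lambda>p\<in>po. \<lambda>t\<in>{1..m}. \<phi> k (As t p))"

definition labellings :: "nat \<Rightarrow> 'k \<Rightarrow> (nat \<times> nat \<Rightarrow> nat \<Rightarrow> 'c) set" where
  "labellings m k = po \<rightarrow>\<^sub>E ({1..m} \<rightarrow>\<^sub>E carrier (T k))"

definition admissible :: "nat \<Rightarrow> 'k \<Rightarrow> (nat \<times> nat \<Rightarrow> nat \<Rightarrow> 'c) \<Rightarrow> bool" where
  "admissible m k g \<longleftrightarrow> inj_on (\<lambda>i. g (i, i)) {1..n} \<and>
     (\<forall>i j. covered_by po i j \<longrightarrow> g (i, j) \<notin> line m (T k) (g (i, i)) (g (j, j)))"

lemma separates_iff_admissible:
  assumes k: "k \<in> K"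
  shows "separates (As ` {1..m}) (T k) (\<phi> k) \<longleftrightarrow> admissible m k (reduction m As k)"
proof -
  let ?g = "reduction m As k"
  have g: "?g (i, j) = (\<lambda>t\<in>{1..m}. \<phi> k (As t (i, j)))" if "(i, j) \<in> po" for i j
    using that k by (simp add: reduction_def)
  have gd: "?g (i, i) = (\<lambda>t\<in>{1..m}. \<phi> k (As t (i, i)))" if "i \<in> {1..n}" for i
    using g po_refl[OF that] by blast
  have eq: "(\<lambda>t\<in>{1..m}. a t) = (\<lambda>t\<in>{1..m}. b t) \<longleftrightarrow> (\<forall>t\<in>{1..m}. a t = b t)" for a b :: "nat \<Rightarrow> 'c"
    by (auto simp: fun_eq_iff restrict_def)
  have "inj_on (\<lambda>i. ?g (i, i)) {1..n} \<longleftrightarrow> (\<forall>i\<in>{1..n}. \<forall>j\<in>{1..n}. i \<noteq> j \<longrightarrow> ?g (i, i) \<noteq> ?g (j, j))"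
    by (auto simp: inj_on_def)
  also have "\<dots> \<longleftrightarrow> (\<forall>i\<in>{1..n}. \<forall>j\<in>{1..n}. i \<noteq> j \<longrightarrow> (\<exists>A\<in>As ` {1..m}. \<phi> k (A (i, i)) \<noteq> \<phi> k (A (j, j))))"
    by (intro ball_cong refl imp_cong) (simp only: gd eq, blast)
  finally have diag: "inj_on (\<lambda>i. ?g (i, i)) {1..n} \<longleftrightarrow> \<dots>" .
  have "?g (i, j) \<notin> line m (T k) (?g (i, i)) (?g (j, j)) \<longleftrightarrow>
      (\<forall>z\<in>ring_center (T k). \<exists>A\<in>As ` {1..m}.
        \<phi> k (A (i, j)) \<noteq> (\<phi> k (A (i, i)) \<ominus>\<^bsub>T k\<^esub> \<phi> k (A (j, j))) \<otimes>\<^bsub>T k\<^esub> z)"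
    if cov: "covered_by po i j" for i j
  proof -
    note ij = cover_facts[OF cov]
    have "?g (i, j) \<notin> line m (T k) (?g (i, i)) (?g (j, j)) \<longleftrightarrow>
      (\<forall>z\<in>ring_center (T k). \<not> (\<forall>t\<in>{1..m}.
        \<phi> k (As t (i, j)) = (?g (i, i) t \<ominus>\<^bsub>T k\<^esub> ?g (j, j) t) \<otimes>\<^bsub>T k\<^esub> z))"
      unfolding line_def image_iff g[OF ij(4)] eq by blast
    also have "\<dots> \<longleftrightarrow> (\<forall>z\<in>ring_center (T k). \<not> (\<forall>t\<in>{1..m}.
        \<phi> k (As t (i, j)) = (\<phi> k (As t (i, i)) \<ominus>\<^bsub>T k\<^esub> \<phi> k (As t (j, j))) \<otimes>\<^bsub>T k\<^esub> z))"
      by (intro ball_cong refl arg_cong[of _ _ Not]) (simp add: gd[OF ij(1)] gd[OF ij(2)])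
    finally show ?thesis
      by blast
  qed
  then have "(\<forall>i j. covered_by po i j \<longrightarrow> ?g (i, j) \<notin> line m (T k) (?g (i, i)) (?g (j, j))) \<longleftrightarrow>
      (\<forall>i j. covered_by po i j \<longrightarrow> (\<forall>z\<in>ring_center (T k). \<exists>A\<in>As ` {1..m}.
        \<phi> k (A (i, j)) \<noteq> (\<phi> k (A (i, i)) \<ominus>\<^bsub>T k\<^esub> \<phi> k (A (j, j))) \<otimes>\<^bsub>T k\<^esub> z))"
    by (intro iff_allI imp_cong refl)
  then show ?thesis
    unfolding admissible_def separates_def diag by (simp only:)
qed

lemma generates_iff_admissible:
  assumes As: "As \<in> tuples m (carrier \<A>)"
  shows "generates \<A> (As ` {1..m} \<union> scalar_matrices n R) \<longleftrightarrow>
    (\<forall>k\<in>K. admissible m k (reduction m As k))"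
proof -
  have G: "As ` {1..m} \<subseteq> carrier \<A>"
    using As by (auto simp: tuples_def)
  have "generates \<A> (As ` {1..m} \<union> scalar_matrices n R) \<longleftrightarrow> (\<forall>k\<in>K. separates (As ` {1..m}) (T k) (\<phi> k))"
    unfolding generates_def
    using generators_separate[OF T_ring T_one_neq_zero hom G] separating_generates[OF T_ring hom surj proper_ideal_killed G]
    by blast
  then show ?thesis
    using separates_iff_admissible by blast
qed

lemma finite_inc: "finite (carrier \<A>)"
  unfolding inc_carrier_PiE using fin_R by (intro finite_PiE) auto

lemma finite_T: "k \<in> K \<Longrightarrow> finite (carrier (T k))"
  using surj fin_R by (metis finite_imageI)

lemma finite_labellings: "k \<in> K \<Longrightarrow> finite (labellings m k)"
  unfolding labellings_def using finite_T by (intro finite_PiE finite_po) auto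

lemma reduction_in:
  assumes As: "As \<in> tuples m (carrier \<A>)"
  shows "reduction m As \<in> (\<Pi>\<^sub>E k\<in>K. labellings m k)"
proof (rule PiE_I)
  fix k assume k: "k \<in> K"
  have "\<phi> k (As t p) \<in> carrier (T k)" if t: "t \<in> {1..m}" and p: "p \<in> po" for t p
  proof -
    obtain i j where "p = (i, j)" "i \<in> {1..n}" "j \<in> {1..n}"
      using p po_range by (metis surj_pair)
    moreover have "As t \<in> carrier \<A>"
      using As t by (auto simp: tuples_def)
    ultimately show ?thesis
      using ring_hom_closed[OF hom[OF k]] by simp
  qed
  then show "reduction m As k \<in> labellings m k"
    using k by (auto simp: reduction_def labellings_def)
qed (simp add: reduction_def)

text \<open>
  The entries of the tuple in positions \<open>i \<preceq> j\<close> can be lifted independently, each in \<open>N\<close> ways; all other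
  entries are zero.
\<close>

lemma reduction_fibre:
  assumes y: "y \<in> (\<Pi>\<^sub>E k\<in>K. labellings m k)"
  shows "card {As \<in> tuples m (carrier \<A>). reduction m As = y} = (N ^ card po) ^ m"
proof -
  define F where "F t p = (if p \<in> po then {r \<in> carrier R. \<forall>k\<in>K. \<phi> k r = y k p t} else {\<zero>})" for t p
  have yl: "y k \<in> po \<rightarrow>\<^sub>E ({1..m} \<rightarrow>\<^sub>E carrier (T k))" if "k \<in> K" for k
    using y that by (auto simp: labellings_def)
  have y_eq: "reduction m As = y \<longleftrightarrow> (\<forall>k\<in>K. \<forall>p\<in>po. \<forall>t\<in>{1..m}. \<phi> k (As t p) = y k p t)" for As
  proof
    assume "\<forall>k\<in>K. \<forall>p\<in>po. \<forall>t\<in>{1..m}. \<phi> k (As t p) = y k p t"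
    then have *: "\<phi> k (As t p) = y k p t" if "k \<in> K" "p \<in> po" "t \<in> {1..m}" for k p t
      using that by blast
    show "reduction m As = y"
    proof
      fix k
      show "reduction m As k = y k"
      proof (cases "k \<in> K")
        case k: True
        show ?thesis
        proof
          fix p
          show "reduction m As k p = y k p"
          proof (cases "p \<in> po")
            case p: True
            show ?thesis
            proof
              fix t
              show "reduction m As k p t = y k p t"
              proof (cases "t \<in> {1..m}")
                case True
                then show ?thesis
                  using *[OF k p] k p by (simp add: reduction_def)
              next
                case False
                then show ?thesis
                  using PiE_arb[OF PiE_mem[OF yl[OF k] p] False] k p by (auto simp: reduction_def)
              qed
            qed
          next
            case False
            then show ?thesis
              using PiE_arb[OF yl[OF k] False] k by (simp add: reduction_def)
          qed
        qed
      next
        case False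
        then show ?thesis
          using PiE_arb[OF y False] by (simp add: reduction_def)
      qed
    qed
  qed (auto simp: reduction_def)
  have "{As \<in> tuples m (carrier \<A>). reduction m As = y} = (\<Pi>\<^sub>E t\<in>{1..m}. \<Pi>\<^sub>E p\<in>{1..n} \<times> {1..n}. F t p)"
  proof (intro Set.set_eqI iffI)
    fix As assume "As \<in> {As \<in> tuples m (carrier \<A>). reduction m As = y}"
    then have As: "As \<in> {1..m} \<rightarrow>\<^sub>E carrier \<A>"
      and eq: "\<And>k p t. k \<in> K \<Longrightarrow> p \<in> po \<Longrightarrow> t \<in> {1..m} \<Longrightarrow> \<phi> k (As t p) = y k p t"
      using y_eq[of As] by (auto simp: tuples_def)
    show "As \<in> (\<Pi>\<^sub>E t\<in>{1..m}. \<Pi>\<^sub>E p\<in>{1..n} \<times> {1..n}. F t p)"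
    proof (rule PiE_I)
      fix t assume t: "t \<in> {1..m}"
      then have At: "As t \<in> (\<Pi>\<^sub>E p\<in>{1..n} \<times> {1..n}. if p \<in> po then carrier R else {\<zero>})"
        using As inc_carrier_PiE by blast
      show "As t \<in> (\<Pi>\<^sub>E p\<in>{1..n} \<times> {1..n}. F t p)"
      proof (rule PiE_I)
        fix p assume "p \<in> {1..n} \<times> {1..n}"
        then have "As t p \<in> (if p \<in> po then carrier R else {\<zero>})"
          using At by (rule PiE_mem[rotated])
        then show "As t p \<in> F t p"
          using eq[OF _ _ t] by (simp add: F_def split: if_splits)
      qed (rule PiE_arb[OF At])
    qed (rule PiE_arb[OF As])
  next
    fix As assume As: "As \<in> (\<Pi>\<^sub>E t\<in>{1..m}. \<Pi>\<^sub>E p\<in>{1..n} \<times> {1..n}. F t p)"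
    have mem: "As t p \<in> F t p" if "t \<in> {1..m}" "p \<in> {1..n} \<times> {1..n}" for t p
      using PiE_mem[OF PiE_mem[OF As that(1)] that(2)] .
    have "As t \<in> carrier \<A>" if t: "t \<in> {1..m}" for t
      unfolding inc_carrier_PiE
    proof (rule PiE_I)
      fix p assume "p \<in> {1..n} \<times> {1..n}"
      then show "As t p \<in> (if p \<in> po then carrier R else {\<zero>})"
        using mem[OF t, of p] by (auto simp: F_def split: if_splits)
    qed (rule PiE_arb[OF PiE_mem[OF As t]])
    then have "As \<in> tuples m (carrier \<A>)"
      unfolding tuples_def using PiE_arb[OF As] by (intro PiE_I)
    moreover have "\<phi> k (As t p) = y k p t" if "k \<in> K" "p \<in> po" "t \<in> {1..m}" for k p t
    proof -
      have "p \<in> {1..n} \<times> {1..n}"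
        using that(2) partial_order_onD(4)[OF po] by blast
      then show ?thesis
        using mem[OF that(3), of p] that by (simp add: F_def)
    qed
    ultimately show "As \<in> {As \<in> tuples m (carrier \<A>). reduction m As = y}"
      using y_eq[of As] by blast
  qed
  then have "card {As \<in> tuples m (carrier \<A>). reduction m As = y} =
      (\<Prod>t\<in>{1..m}. \<Prod>p\<in>{1..n} \<times> {1..n}. card (F t p))"
    by (simp add: card_PiE)
  also have "\<dots> = (\<Prod>t\<in>{1..m}. N ^ card po)"
  proof (rule prod.cong)
    fix t assume t: "t \<in> {1..m}"
    have "card (F t p) = N" if p: "p \<in> po" for p
    proof -
      have "y k p t \<in> carrier (T k)" if "k \<in> K" for k
        using yl[OF that] p t by blast
      then have "(\<lambda>k\<in>K. y k p t) \<in> (\<Pi>\<^sub>E k\<in>K. carrier (T k))"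
        by auto
      then have "card {r \<in> carrier R. \<forall>k\<in>K. \<phi> k r = (\<lambda>k\<in>K. y k p t) k} = N"
        by (rule fibre_card)
      then show ?thesis
        using p by (simp add: F_def)
    qed
    then have "(\<Prod>p\<in>{1..n} \<times> {1..n}. card (F t p)) = (\<Prod>p\<in>{1..n} \<times> {1..n}. if p \<in> po then N else 1)"
      by (intro prod.cong) (auto simp: F_def)
    also have "\<dots> = N ^ card (({1..n} \<times> {1..n}) \<inter> po)"
      by (simp add: prod.If_cases)
    also have "({1..n} \<times> {1..n}) \<inter> po = po"
      using partial_order_onD(4)[OF po] by blast
    finally show "(\<Prod>p\<in>{1..n} \<times> {1..n}. card (F t p)) = N ^ card po" .
  qed simp
  finally show ?thesis
    by simp
qed

lemma generation_probability_factors: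
  "real (card (Gen m \<A> n R)) / real (card (tuples m (carrier \<A>))) =
    (\<Prod>k\<in>K. real (card {g \<in> labellings m k. admissible m k g}) / real (card (labellings m k)))"
proof -
  let ?X = "tuples m (carrier \<A>)" and ?Y = "\<Pi>\<^sub>E k\<in>K. labellings m k"
  have finX: "finite ?X"
    unfolding tuples_def using finite_inc by (intro finite_PiE) auto
  have finY: "finite ?Y"
    using fin_K finite_labellings by (intro finite_PiE) auto
  note count = card_constant_fibres[OF finX finY reduction_in reduction_fibre]
  have "Gen m \<A> n R = {As \<in> ?X. \<forall>k\<in>K. admissible m k (reduction m As k)}"
    unfolding Gen_def using generates_iff_admissible by blast
  then have "card (Gen m \<A> n R) = (N ^ card po) ^ m * card {y \<in> ?Y. \<forall>k\<in>K. admissible m k (y k)}"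
    using count[where P = "\<lambda>y. \<forall>k\<in>K. admissible m k (y k)"] by simp
  also have "{y \<in> ?Y. \<forall>k\<in>K. admissible m k (y k)} = (\<Pi>\<^sub>E k\<in>K. {g \<in> labellings m k. admissible m k g})"
    by (auto simp: PiE_def Pi_def)
  also have "card \<dots> = (\<Prod>k\<in>K. card {g \<in> labellings m k. admissible m k g})"
    using fin_K by (rule card_PiE)
  finally have num: "card (Gen m \<A> n R) =
      (N ^ card po) ^ m * (\<Prod>k\<in>K. card {g \<in> labellings m k. admissible m k g})" .
  have "card ?X = (N ^ card po) ^ m * card ?Y"
    using count[where P = "\<lambda>_. True"] by simp
  also have "card ?Y = (\<Prod>k\<in>K. card (labellings m k))"
    using fin_K by (rule card_PiE)
  finally have den: "card ?X = (N ^ card po) ^ m * (\<Prod>k\<in>K. card (labellings m k))" .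
  show ?thesis
    using N_pos by (simp add: num den prod_dividef)
qed

lemma generation_probability:
  assumes n: "n \<ge> 1"
  shows "real (card (Gen m \<A> n R)) / real (card (tuples m (carrier \<A>))) =
    (\<Prod>k\<in>K. (1 - real (card (ring_center (T k))) / real (card (carrier (T k)) ^ m)) ^ card covers *
      (\<Prod>l = 1..n - 1. 1 - real l / real (card (carrier (T k)) ^ m)))"
  unfolding generation_probability_factors
proof (rule prod.cong)
  fix k assume k: "k \<in> K"
  let ?V = "{1..m} \<rightarrow>\<^sub>E carrier (T k)"
  have V: "finite ?V" "card ?V = card (carrier (T k)) ^ m"
    using finite_T[OF k] by (auto simp: card_funcsetE intro: finite_PiE)
  have "\<zero>\<^bsub>T k\<^esub> \<in> carrier (T k)"
    using ring.ring_simprules(2)[OF T_ring[OF k]] .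
  then have ne: "?V \<noteq> {}"
    by (auto simp: PiE_eq_empty_iff)
  have "line m (T k) v w \<subseteq> ?V \<and> card (line m (T k) v w) = card (ring_center (T k))"
    if "v \<in> ?V" "w \<in> ?V" "v \<noteq> w" for v w
    using line_card[OF simple[OF k] that] by blast
  from labelling_probability[OF n V(1) ne this]
  show "real (card {g \<in> labellings m k. admissible m k g}) / real (card (labellings m k)) =
    (1 - real (card (ring_center (T k))) / real (card (carrier (T k)) ^ m)) ^ card covers *
      (\<Prod>l = 1..n - 1. 1 - real l / real (card (carrier (T k)) ^ m))"
    unfolding labellings_def admissible_def V(2) .
qed simp

end

theorem corollary8:
  fixes R :: "('a, 'b) ring_scheme"
    and F :: "nat \<Rightarrow> 'f ring"
    and q ns :: "nat \<Rightarrow> nat"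
    and d n m c :: nat
    and po :: "nat rel"
    and \<A> :: "(nat \<times> nat \<Rightarrow> 'a) ring"
  assumes "ring R" and "finite (carrier R)" and "\<one>\<^bsub>R\<^esub> \<noteq> \<zero>\<^bsub>R\<^esub>"
    and "\<And>i. i \<in> {1..d} \<Longrightarrow> field (F i)"
    and "\<And>i. i \<in> {1..d} \<Longrightarrow> finite (carrier (F i))"
    and "\<And>i. i \<in> {1..d} \<Longrightarrow> card (carrier (F i)) = q i"
    and "\<And>i. i \<in> {1..d} \<Longrightarrow> ns i \<ge> 1"
    and "R Quot (jacobson_radical R) \<simeq>
           RDirProd_list (map (\<lambda>i. mat_ring (ns i) (F i)) [1..<Suc d])"
    and "n \<ge> 1"
    and "partial_order_on {1..n} po"
    and "\<A> = incidence_ring n po R"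
    and "c = card {(i, j). covered_by po i j}"
    and "m \<ge> mgen \<A> n R"
  shows "real (card (Gen m \<A> n R)) / real (card (tuples m (carrier \<A>))) =
    (\<Prod>i = 1..d.
       (1 - 1 / real (q i) powi (int ((ns i)\<^sup>2 * m) - 1)) ^ c *
       (\<Prod>l = 1..n - 1. 1 - real l / real (q i) ^ ((ns i)\<^sup>2 * m)))"
proof -
  let ?T = "\<lambda>i. mat_ring (ns i) (F i)"
  have simple: "simple_ring (?T i)" if "i \<in> {1..d}" for i
    using field.mat_ring_simple assms(4,7) that by blast
  obtain \<phi> where "wedderburn_quotients R {1..d} ?T \<phi> (card (jacobson_radical R))"
    using ring.wedderburn_decomposition[OF assms(1,2,8) simple] by blast
  then interpret incidence_wedderburn R n po "{1..d}" ?T \<phi> "card (jacobson_radical R)"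
    using assms(1,10) by (intro incidence_wedderburn.intro incidence.intro incidence_axioms.intro)
  have q: "q i > 0" if "i \<in> {1..d}" for i
  proof -
    have "\<zero>\<^bsub>F i\<^esub> \<in> carrier (F i)"
      using assms(4)[OF that] by (intro ring.ring_simprules(2) cring.axioms(1) fieldE(1))
    then show ?thesis
      using assms(5,6)[OF that] by (metis card_gt_0_iff empty_iff)
  qed
  have order: "card (carrier (?T i)) ^ m = q i ^ ((ns i)\<^sup>2 * m)" if "i \<in> {1..d}" for i
    using assms(6)[OF that] by (simp add: card_mat_ring power_mult)
  have center: "card (ring_center (?T i)) = q i" if "i \<in> {1..d}" for i
    using field.card_mat_ring_center[OF assms(4)[OF that] assms(7)[OF that]] assms(6)[OF that] by simp
  have powi: "real (q i) / real (q i ^ ((ns i)\<^sup>2 * m)) = 1 / real (q i) powi (int ((ns i)\<^sup>2 * m) - 1)"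
    if "i \<in> {1..d}" for i
    using q[OF that] by (simp add: power_int_diff del: of_nat_mult)
  have "card covers = c"
    by (simp add: covers_def assms(12))
  then show ?thesis
    unfolding assms(11) generation_probability[OF assms(9)]
    by (intro prod.cong) (auto simp only: order center powi[symmetric] of_nat_power)
qed

end
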